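(* Let $F>2$, let $W=(H,Q)$ be an $X$-periodic roll wave of the inviscid Saint-Venant equations with speed $c$, and let $\Delta(\lambda,\xi)$ be its periodic Evans-Lopatinsky determinant. Then $\lambda=0$ is a double root (i.e. a root of multiplicity at least two) of $\Delta(\cdot,\xi)$ for some nonzero $\xi\in[-\pi/X,\pi/X]$ if and only if it is a double root of $\Delta(\cdot,\xi)$ for every $\xi\in[-\pi/X,\pi/X]$.
   Context: Equations. The inviscid Saint-Venant equations are $\partial_t h+\partial_x q=0$, $\partial_t q+\partial_x\big(\tfrac{q^2}{h}+\tfrac{h^2}{2F^2}\big)=h-\tfrac{|q|q}{h^2}$, with Froude number $F$. Roll waves. Fix $F>2$. A roll wave is determined by $H_s>0$ and $H_-$ with $\frac{1+2F+\sqrt{1+4F}}{2F^2}H_s<H_-<H_s$. Put $q_0=H_s^{3/2}/F$, $c=H_s^{1/2}(1+1/F)$, and let $H_+>H_s$ be the unique solution of $\frac{q_0^2}{H_+}+\frac{H_+^2}{2F^2}=\frac{q_0^2}{H_-}+\frac{H_-^2}{2F^2}$. Let $H:[0,X]\to[H_-,H_+]$ be the (increasing) solution of $H'=F^2\,\frac{H^2+(H_s-c^2)H+q_0^2/H_s}{H^2+H_sH+H_s^2}$ with $H(0)=H_-$, where $X>0$ is determined by $H(X)=H_+$, and let $Q=cH-q_0$. The $X$-periodic extension of $(H,Q)|_{(0,X)}$, with shocks at $jX$, $j\in\mathbb{Z}$, is the profile $W$, and $(h,q)(x,t)=(H,Q)(x-ct)$ is the roll wave. Let $x_s\in(0,X)$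 be the sonic point, where $H(x_s)=H_s$. Interior eigenvalue equations. For $\lambda\in\mathbb{C}$, consider on $(0,X)$ $$\lambda h+\partial_x(-ch+q)=0,\qquad \lambda q+\partial_x\Big(\big(\tfrac{2Q}{H}-c\big)q+\big(-\tfrac{Q^2}{H^2}+\tfrac{H}{F^2}\big)h\Big)=h-\tfrac{2Q}{H^2}q+\tfrac{2Q^2}{H^3}h.$$ This system is singular at $x_s$. For $\Re(\lambda)>-\tfrac{F-2}{2\sqrt{H_s}}$ its space of analytic solutions on the closed cell is one-dimensional; $(h,q)=(h,q)(\cdot;\lambda)$ denotes the analytic solution (depending analytically on $\lambda$) normalized by $$\begin{pmatrix}h\\ q\end{pmatrix}(x_s)=\frac{F-2}{2(F+1)}\sqrt{H_s}\begin{pmatrix}\big(\lambda+\tfrac23\tfrac{F+1}{\sqrt{H_s}}\big)F\\ \lambda\sqrt{H_s}(F-1)+\tfrac23(F+1)^2\end{pmatrix}.$$ Evans-Lopatinsky determinant. For $\Re(\lambda)>-\tfrac{F-2}{2\sqrt{H_s}}$ and $\xi\in[-\pi/X,\pi/X]$, with $\{f\}:=f(X^-)-f(0^+)$ and $\{f\}_\xi:=f(X^-)-e^{i\xi X}f(0^+)$, $$\Delta(\lambda,\xi):=\det\begin{pmatrix}\{\lambda H\}&\{-ch+q\}_\xi\\ \{\lambda Q-(H-\tfrac{Q^2}{H^2})\}&\{(-\tfrac{Q^2}{H^2}+\tfrac{H}{F^2})h+(\tfrac{2Q}{H}-c)q\}_\xi\end{pmatrix}.$$ *)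

theory Defs
  imports "HOL-Complex_Analysis.Complex_Analysis"
begin

text \<open>The constants \<open>q\<^sub>0\<close> and \<open>c\<close> of the roll wave with Froude number \<open>F\<close> and sonic height \<open>Hs\<close>.\<close>

definition rw_q0 :: "real \<Rightarrow> real \<Rightarrow> real" where
  "rw_q0 F Hs = Hs powr (3/2) / F"

definition rw_speed :: "real \<Rightarrow> real \<Rightarrow> real" where
  "rw_speed F Hs = sqrt Hs * (1 + 1/F)"

text \<open>
  \<open>H\<close> is the smooth profile on the closed cell \<open>[0, X]\<close>, increasing from
  \<open>Hm\<close> to \<open>Hp\<close>; the equation relating \<open>Hm\<close> and \<open>Hp\<close> is the Rankine-Hugoniot condition for
  the shock joining two consecutive cells.
\<close>

definition cell_profile ::
  "real \<Rightarrow> real \<Rightarrow> real \<Rightarrow> real \<Rightarrow> real \<Rightarrow> (real \<Rightarrow> real) \<Rightarrow> bool" where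
  "cell_profile F Hs Hm Hp X H \<longleftrightarrow>
     0 < Hs \<and>
     (1 + 2*F + sqrt (1 + 4*F)) / (2 * F^2) * Hs < Hm \<and> Hm < Hs \<and>
     Hs < Hp \<and>
     (rw_q0 F Hs)^2 / Hp + Hp^2 / (2 * F^2) = (rw_q0 F Hs)^2 / Hm + Hm^2 / (2 * F^2) \<and>
     0 < X \<and>
     H ` {0..X} \<subseteq> {Hm..Hp} \<and> strict_mono_on {0..X} H \<and>
     (\<forall>x\<in>{0..X}. (H has_real_derivative
        F^2 * ((H x)^2 + (Hs - (rw_speed F Hs)^2) * H x + (rw_q0 F Hs)^2 / Hs)
            / ((H x)^2 + Hs * H x + Hs^2)) (at x within {0..X})) \<and>
     H 0 = Hm \<and> H X = Hp"

text \<open>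
  \<open>(H, Q)\<close> is the \<open>X\<close>-periodic extension to the line of the cell profile restricted to the open
  cell. Its values at the shocks \<open>j * X\<close> are left unspecified.
\<close>

definition roll_wave ::
  "real \<Rightarrow> real \<Rightarrow> real \<Rightarrow> real \<Rightarrow> real \<Rightarrow> (real \<Rightarrow> real) \<Rightarrow> (real \<Rightarrow> real) \<Rightarrow> bool" where
  "roll_wave F Hs Hm Hp X H Q \<longleftrightarrow>
     (\<exists>H0. cell_profile F Hs Hm Hp X H0 \<and>
        (\<forall>j::int. \<forall>x\<in>{0<..<X}.
           H (x + of_int j * X) = H0 x \<and>
           Q (x + of_int j * X) = rw_speed F Hs * H0 x - rw_q0 F Hs))"

text \<open>Analyticity on a set of real points (in the relative sense at points that are not interior).\<close>

definition real_analytic_on :: "(real \<Rightarrow> complex) \<Rightarrow> real set \<Rightarrow> bool" where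
  "real_analytic_on f S \<longleftrightarrow>
     (\<forall>y\<in>S. \<exists>r>0. \<exists>a :: nat \<Rightarrow> complex. \<forall>x\<in>S. \<bar>x - y\<bar> < r \<longrightarrow>
        (\<lambda>n. a n * of_real (x - y) ^ n) sums f x)"

text \<open>Linearization about \<open>(H, Q)\<close> of the momentum flux, in the frame moving with speed \<open>c\<close>.\<close>

definition lin_flux ::
  "real \<Rightarrow> real \<Rightarrow> (real \<Rightarrow> real) \<Rightarrow> (real \<Rightarrow> real) \<Rightarrow> (real \<Rightarrow> complex) \<Rightarrow> (real \<Rightarrow> complex) \<Rightarrow> real \<Rightarrow> complex" where
  "lin_flux F c H Q h q x =
     of_real (2 * Q x / H x - c) * q x + of_real (- ((Q x)^2 / (H x)^2) + H x / F^2) * h x"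

definition interior_solution ::
  "real \<Rightarrow> real \<Rightarrow> real \<Rightarrow> (real \<Rightarrow> real) \<Rightarrow> (real \<Rightarrow> real) \<Rightarrow> complex \<Rightarrow>
   (real \<Rightarrow> complex) \<Rightarrow> (real \<Rightarrow> complex) \<Rightarrow> bool" where
  "interior_solution F c X H Q \<mu> h q \<longleftrightarrow>
     (\<forall>x\<in>{0<..<X}.
        ((\<lambda>y. - of_real c * h y + q y) has_vector_derivative - (\<mu> * h x)) (at x) \<and>
        (lin_flux F c H Q h q has_vector_derivative
           h x - of_real (2 * Q x / (H x)^2) * q x + of_real (2 * (Q x)^2 / (H x)^3) * h x
             - \<mu> * q x) (at x))"

definition spectral_domain :: "real \<Rightarrow> real \<Rightarrow> complex set" where
  "spectral_domain F Hs = {\<mu>. Re \<mu> > - (F - 2) / (2 * sqrt Hs)}"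

text \<open>
  \<open>h \<mu> x\<close> and \<open>q \<mu> x\<close> are the components at \<open>x\<close> of the analytic solution for the spectral
  parameter \<open>\<mu>\<close>, normalized at the sonic point \<open>xs\<close>. Analytic dependence on \<open>\<mu>\<close> is only
  required pointwise in \<open>x\<close>.
\<close>

definition normalized_solutions ::
  "real \<Rightarrow> real \<Rightarrow> real \<Rightarrow> real \<Rightarrow> (real \<Rightarrow> real) \<Rightarrow> (real \<Rightarrow> real) \<Rightarrow>
   (complex \<Rightarrow> real \<Rightarrow> complex) \<Rightarrow> (complex \<Rightarrow> real \<Rightarrow> complex) \<Rightarrow> bool" where
  "normalized_solutions F Hs X xs H Q h q \<longleftrightarrow>
     (\<forall>\<mu>\<in>spectral_domain F Hs.
        real_analytic_on (h \<mu>) {0..X} \<and> real_analytic_on (q \<mu>) {0..X} \<and>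
        interior_solution F (rw_speed F Hs) X H Q \<mu> (h \<mu>) (q \<mu>) \<and>
        h \<mu> xs = of_real ((F - 2) / (2 * (F + 1)) * sqrt Hs) *
                   ((\<mu> + of_real (2/3 * (F + 1) / sqrt Hs)) * of_real F) \<and>
        q \<mu> xs = of_real ((F - 2) / (2 * (F + 1)) * sqrt Hs) *
                   (\<mu> * of_real (sqrt Hs * (F - 1)) + of_real (2/3 * (F + 1)^2))) \<and>
     (\<forall>x\<in>{0..X}. (\<lambda>\<mu>. h \<mu> x) holomorphic_on spectral_domain F Hs \<and>
                  (\<lambda>\<mu>. q \<mu> x) holomorphic_on spectral_domain F Hs)"

definition jump :: "real \<Rightarrow> (real \<Rightarrow> complex) \<Rightarrow> complex" where
  "jump X f = Lim (at_left X) f - Lim (at_right 0) f"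

definition bloch_jump :: "real \<Rightarrow> real \<Rightarrow> (real \<Rightarrow> complex) \<Rightarrow> complex" where
  "bloch_jump X \<xi> f = Lim (at_left X) f - exp (\<i> * of_real (\<xi> * X)) * Lim (at_right 0) f"

definition evans_lopatinsky ::
  "real \<Rightarrow> real \<Rightarrow> real \<Rightarrow> (real \<Rightarrow> real) \<Rightarrow> (real \<Rightarrow> real) \<Rightarrow>
   (complex \<Rightarrow> real \<Rightarrow> complex) \<Rightarrow> (complex \<Rightarrow> real \<Rightarrow> complex) \<Rightarrow> complex \<Rightarrow> real \<Rightarrow> complex" where
  "evans_lopatinsky F c X H Q h q \<mu> \<xi> =
     det (vector [
       vector [jump X (\<lambda>x. \<mu> * of_real (H x)),
               bloch_jump X \<xi> (\<lambda>x. - of_real c * h \<mu> x + q \<mu> x)],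
       vector [jump X (\<lambda>x. \<mu> * of_real (Q x) - of_real (H x - (Q x)^2 / (H x)^2)),
               bloch_jump X \<xi> (lin_flux F c H Q (h \<mu>) (q \<mu>))]] :: complex^2^2)"

text \<open>
  Order of vanishing at least \<open>n\<close>. Unlike \<^const>\<open>zorder\<close>, this also covers a function that
  vanishes identically near \<open>z\<close>.
\<close>

definition root_of_mult_ge :: "nat \<Rightarrow> (complex \<Rightarrow> complex) \<Rightarrow> complex \<Rightarrow> bool" where
  "root_of_mult_ge n f z \<longleftrightarrow>
     (\<exists>g. g analytic_on {z} \<and> (\<forall>\<^sub>F w in nhds z. f w = (w - z) ^ n * g w))"

end

theory Submission imports Defs begin

text \<open>
  Let \<open>u = q - c h\<close> and let \<open>v\<close> be the linearized momentum flux. The derivative of the profile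
  solves the interior equations at \<open>\<mu> = 0\<close>, and the normalization at the sonic point selects exactly
  \<open>h = H'\<close>, \<open>u = 0\<close>, \<open>v = S = H - Q\<^sup>2 / H\<^sup>2\<close>; in particular \<open>\<Delta>(0,\<xi>) = 0\<close>. Since \<open>u' = - \<mu> h\<close>, the
  derivative of \<open>u\<close> in \<open>\<mu>\<close> at \<open>0\<close> is \<open>K - H\<close> with a constant \<open>K\<close>. Hence, with \<open>E = exp (\<i> \<xi> X)\<close>,
  the derivative of \<open>\<Delta>(\<cdot>,\<xi>)\<close> at \<open>0\<close> is
  \<open>(Hp - Hm) (S(Hp) - E S(Hm)) + (S(Hp) - S(Hm)) ((K - Hp) - E (K - Hm))\<close>, which is affine in \<open>E\<close> and
  vanishes at \<open>E = 1\<close>: it is \<open>1 - E\<close> times a number that does not depend on \<open>\<xi>\<close>.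

  Because the solutions are only assumed to be holomorphic in \<open>\<mu>\<close> for each fixed \<open>x\<close>, passing to the
  limit in \<open>u(x) = u(xs) - \<mu> \<integral> h\<close> needs a bound uniform in \<open>x\<close>. It suffices to let \<open>\<mu>\<close> tend to \<open>0\<close> along
  the positive reals, where the singular equation for \<open>h / H'\<close> is damped on both sides of the sonic
  point and a weighted maximum argument gives \<open>h / H' = 1 + O(\<mu>)\<close> uniformly on the cell.
\<close>

section \<open>A weighted maximum principle for damped singular equations\<close>

text \<open>At a nonzero maximum of \<open>exp (- 2 * L * x) * norm (w x)^2\<close> the derivative
  of this function cannot be negative, the damping term with \<open>\<gamma>\<close> has the
  favourable sign, and the factor \<open>S\<close> in the forcing bound cancels the singular
  coefficient of \<open>w'\<close>. The forcing bound is nonlocal: \<open>B\<close> is any bound of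
  \<open>w\<close> on \<open>{0..y}\<close>, which admits a \<open>g\<close> containing an integral
  of \<open>w\<close>.\<close>

lemma damped_singular_bound:
  fixes w g :: "real \<Rightarrow> complex" and S \<gamma> :: "real \<Rightarrow> real"
  assumes cont: "continuous_on {0..T} w" and w0: "w 0 = 0"
    and ode: "\<And>y. y \<in> {0<..<T} \<Longrightarrow> \<exists>w'. (w has_vector_derivative w') (at y) \<and>
          S y *\<^sub>R w' = - (\<mu> * \<gamma> y) *\<^sub>R w y - \<mu> *\<^sub>R g y"
    and S: "\<And>y. y \<in> {0<..<T} \<Longrightarrow> S y > 0"
    and \<gamma>: "\<And>y. y \<in> {0<..<T} \<Longrightarrow> \<gamma> y \<ge> 0"
    and \<mu>: "0 < \<mu>" "\<mu> \<le> 1" and C: "C \<ge> 0"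
    and g: "\<And>y B. y \<in> {0<..<T} \<Longrightarrow> (\<And>z. z \<in> {0..y} \<Longrightarrow> norm (w z) \<le> B) \<Longrightarrow>
          norm (g y) \<le> C * S y * (1 + B)"
    and y: "y \<in> {0..T}"
  shows "norm (w y) \<le> \<mu> * C * exp ((1 + C) * T)"
proof -
  \<comment> \<open>A rate exceeding \<open>C\<close> by \<open>1\<close> leaves one full multiple
    of \<open>norm (w z)\<close> after the part of the forcing proportional to
    \<open>norm (w z)\<close> is absorbed.\<close>
  define L where "L = 1 + C"
  have L: "L > 0" using C by (simp add: L_def)
  \<comment> \<open>The equation holds on the open interval, so the maximum is taken over
    \<open>{0..t}\<close> with \<open>t < T\<close>; the end \<open>T\<close> follows by
    continuity.\<close>
  have inner: "norm (w t) \<le> \<mu> * C * exp (L * T)" if t: "t \<in> {0<..<T}" for t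
  proof -
    define f where "f x = (w x \<bullet> w x) * exp (- 2 * L * x)" for x
    have "continuous_on {0..t} f"
      unfolding f_def using t by (intro continuous_intros continuous_on_subset[OF cont]) auto
    then obtain z where z: "z \<in> {0..t}" and max: "\<And>x. x \<in> {0..t} \<Longrightarrow> f x \<le> f z"
      using continuous_attains_sup[of "{0..t}" f] t by auto
    have wz: "norm (w z) \<le> \<mu> * C"
    proof (cases "w z = 0")
      case True
      then show ?thesis using \<mu> C by simp
    next
      case False
      then have zT: "z \<in> {0<..<T}" using z w0 t by (cases "z = 0") auto
      obtain w' where w': "(w has_vector_derivative w') (at z)"
        and eq: "S z *\<^sub>R w' = - (\<mu> * \<gamma> z) *\<^sub>R w z - \<mu> *\<^sub>R g z"
        using ode[OF zT] by blast
      have "((\<lambda>x. w x \<bullet> w x) has_real_derivative 2 * (w z \<bullet> w')) (at z)"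
        using has_derivative_inner[OF w'[unfolded has_vector_derivative_def] w'[unfolded has_vector_derivative_def]]
        unfolding has_field_derivative_def
        by (rule has_derivative_eq_rhs) (auto simp: fun_eq_iff inner_commute algebra_simps)
      then have df: "(f has_real_derivative
          exp (- 2 * L * z) * (2 * (w z \<bullet> w') - 2 * L * (w z \<bullet> w z))) (at z)"
        unfolding f_def by (auto intro!: derivative_eq_intros simp: algebra_simps)
      \<comment> \<open>The maximum point \<open>z\<close> may be the right end \<open>t\<close>, so
        it is compared with points to its left.\<close>
      have "exp (- 2 * L * z) * (2 * (w z \<bullet> w') - 2 * L * (w z \<bullet> w z)) \<ge> 0"
      proof (rule ccontr)
        assume "\<not> ?thesis"
        then obtain d where d: "d > 0" "\<And>h. 0 < h \<Longrightarrow> h < d \<Longrightarrow> f z < f (z - h)"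
          using DERIV_neg_dec_left[OF df] by fastforce
        have "f z < f (z - min (d/2) z)"
          by (rule d(2)) (use d(1) zT in auto)
        moreover have "f (z - min (d/2) z) \<le> f z"
          by (rule max) (use d(1) z in auto)
        ultimately show False by simp
      qed
      then have le: "L * (norm (w z))^2 \<le> w z \<bullet> w'"
        by (simp add: zero_le_mult_iff power2_norm_eq_inner)
      \<comment> \<open>The weight decreases, so to the left of \<open>z\<close> maximality of
        \<open>f\<close> passes to \<open>norm (w x)\<close>. This permits
        \<open>B = norm (w z)\<close> in the forcing bound.\<close>
      have "norm (w x) \<le> norm (w z)" if x: "x \<in> {0..z}" for x
      proof -
        have "f x \<le> f z" using x z by (intro max) auto
        moreover have "exp (- 2 * L * z) \<le> exp (- 2 * L * x)" using x L by auto
        then have "(w z \<bullet> w z) * exp (- 2 * L * z) \<le> (w z \<bullet> w z) * exp (- 2 * L * x)"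
          by (intro mult_left_mono) auto
        ultimately have "(w x \<bullet> w x) * exp (- 2 * L * x) \<le> (w z \<bullet> w z) * exp (- 2 * L * x)"
          unfolding f_def by linarith
      then have "w x \<bullet> w x \<le> w z \<bullet> w z" by simp
        then show ?thesis by (simp add: norm_eq_sqrt_inner)
      qed
      then have gz: "norm (g z) \<le> C * S z * (1 + norm (w z))" by (rule g[OF zT])
      have "S z * (w z \<bullet> w') = w z \<bullet> (S z *\<^sub>R w')" by simp
      also have "\<dots> = - (\<mu> * \<gamma> z) * (norm (w z))^2 - \<mu> * (w z \<bullet> g z)"
        unfolding eq by (simp add: inner_diff_right power2_norm_eq_inner)
      also have "\<dots> \<le> - \<mu> * (w z \<bullet> g z)" using \<mu> \<gamma>[OF zT] by simp
      also have "\<dots> \<le> \<mu> * (norm (w z) * norm (g z))"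
        using \<mu> Cauchy_Schwarz_ineq2[of "w z" "g z"] mult_left_mono[of "- (w z \<bullet> g z)" _ \<mu>] by simp
      also have "\<dots> \<le> \<mu> * (norm (w z) * (C * S z * (1 + norm (w z))))"
        using \<mu> gz by (intro mult_left_mono) auto
      finally have "S z * (w z \<bullet> w') \<le> S z * (\<mu> * norm (w z) * C * (1 + norm (w z)))"
        by (simp add: algebra_simps)
      then have "w z \<bullet> w' \<le> \<mu> * norm (w z) * C * (1 + norm (w z))" using S[OF zT] by simp
      with le have "norm (w z) * (L * norm (w z)) \<le> norm (w z) * (\<mu> * C * (1 + norm (w z)))"
        by (simp add: power2_eq_square algebra_simps)
      then have "L * norm (w z) \<le> \<mu> * C * (1 + norm (w z))"
        using False by simp
      also have "\<dots> \<le> \<mu> * C + C * norm (w z)"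
        using \<mu> C mult_right_mono[of \<mu> 1 "C * norm (w z)"] by (simp add: algebra_simps)
      finally show ?thesis by (simp add: L_def algebra_simps)
    qed
    have "f t \<le> f z" using t by (intro max) auto
    then have "(norm (w t) * exp (- L * t))^2 \<le> (norm (w z) * exp (- L * z))^2"
      by (simp add: f_def power_mult_distrib power2_norm_eq_inner mult.assoc flip: exp_double)
    then have "norm (w t) * exp (- L * t) \<le> norm (w z) * exp (- L * z)"
      by (rule power2_le_imp_le) simp
    then have "norm (w t) \<le> norm (w z) * exp (L * (t - z))"
      by (simp add: exp_minus field_simps exp_diff)
    also have "\<dots> \<le> (\<mu> * C) * exp (L * T)"
      using wz L t z \<mu> C by (intro mult_mono) auto
    finally show ?thesis .
  qed
  show ?thesis
  proof (cases "T > 0")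
    case True
    then show ?thesis
      using continuous_on_closure_norm_le[of "{0<..<T}" w "\<mu> * C * exp (L * T)" y] cont inner y
      by (auto simp: L_def)
  next
    case False
    then have "y = 0" using y by auto
    then show ?thesis using w0 \<mu> C by simp
  qed
qed

section \<open>Difference quotients, double roots, real analyticity and one-sided limits\<close>

text \<open>On a compact interval the filled difference quotient is bounded and attains its minimum;
  this is the source of the linear upper and lower bounds around the sonic point.\<close>

lemma slope_continuous_on:
  fixes f :: "real \<Rightarrow> real"
  assumes cont: "continuous_on A f" and df: "(f has_real_derivative D) (at z)"
  shows "continuous_on A (\<lambda>x. if x = z then D else (f x - f z) / (x - z))"
proof (rule continuous_on_eq_continuous_within[THEN iffD2, rule_format])
  fix x assume x: "x \<in> A"
  let ?s = "\<lambda>x. if x = z then D else (f x - f z) / (x - z)"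
  show "continuous (at x within A) ?s"
  proof (cases "x = z")
    case True
    have "((\<lambda>x. (f x - f z) / (x - z)) \<longlongrightarrow> D) (at z)"
      using df by (simp add: has_field_derivative_iff)
    then have "(?s \<longlongrightarrow> D) (at z)"
      by (rule Lim_transform_eventually) (auto simp: eventually_at_filter)
    then show ?thesis
      using True by (auto simp: continuous_within intro: tendsto_within_subset)
  next
    case False
    have "continuous (at x within A) (\<lambda>x. (f x - f z) / (x - z))"
      using cont x False by (intro continuous_intros) (auto simp: continuous_on_eq_continuous_within)
    moreover have "\<forall>\<^sub>F y in at x within A. (f y - f z) / (y - z) = ?s y"
      using False
      by (auto simp: eventually_at_topological intro!: exI[of _ "- {z}"])
    ultimately show ?thesis
      using False Lim_transform_eventually unfolding continuous_within by (simp add: tendsto_cong)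
  qed
qed

lemma slope_bounded:
  fixes f :: "real \<Rightarrow> real"
  assumes cont: "continuous_on {a..b} f" and df: "f differentiable (at z)"
  obtains C where "C > 0" "\<And>x. x \<in> {a..b} \<Longrightarrow> \<bar>f x - f z\<bar> \<le> C * \<bar>x - z\<bar>"
proof -
  obtain D where D: "(f has_real_derivative D) (at z)"
    using df real_differentiable_def by blast
  have "compact ((\<lambda>x. if x = z then D else (f x - f z) / (x - z)) ` {a..b})"
    using slope_continuous_on[OF cont D] by (intro compact_continuous_image) auto
  then obtain C where "C > 0"
    "\<forall>y\<in>(\<lambda>x. if x = z then D else (f x - f z) / (x - z)) ` {a..b}. norm y \<le> C"
    using compact_imp_bounded bounded_pos by blast
  then have C: "C > 0"
    "\<And>x. x \<in> {a..b} \<Longrightarrow> norm (if x = z then D else (f x - f z) / (x - z)) \<le> C"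
    by auto
  show thesis
  proof (rule that[OF C(1)])
    fix x assume "x \<in> {a..b}"
    from C(2)[OF this] show "\<bar>f x - f z\<bar> \<le> C * \<bar>x - z\<bar>"
      by (cases "x = z") (auto simp: divide_simps split: if_splits)
  qed
qed

text \<open>The zeros are divided out one at a time, each quotient having a removable singularity.
  The first quotient takes the value \<open>deriv f z\<close> at \<open>z\<close>, and its vanishing
  permits the second division. The converse is the product rule.\<close>

lemma root_of_mult_ge_2_iff:
  assumes "f analytic_on {z}"
  shows "root_of_mult_ge 2 f z \<longleftrightarrow> f z = 0 \<and> deriv f z = 0"
proof
  assume "root_of_mult_ge 2 f z"
  then obtain g where g: "g analytic_on {z}" and ev: "\<forall>\<^sub>F w in nhds z. f w = (w - z)^2 * g w"
    by (auto simp: root_of_mult_ge_def)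
  have "f z = 0" using eventually_nhds_x_imp_x[OF ev] by simp
  moreover obtain g' where "(g has_field_derivative g') (at z)"
    using analytic_on_imp_differentiable_at[OF g] by (auto simp: field_differentiable_def)
  then have "((\<lambda>w. (w - z)^2 * g w) has_field_derivative 0) (at z)"
    by (auto intro!: derivative_eq_intros)
  then have "deriv f z = 0"
    using deriv_cong_ev[OF ev refl] by (simp add: DERIV_imp_deriv)
  ultimately show "f z = 0 \<and> deriv f z = 0" by blast
next
  assume 0: "f z = 0 \<and> deriv f z = 0"
  obtain r where r: "r > 0" "f holomorphic_on ball z r"
    using assms by (auto simp: analytic_on_def)
  define g1 where "g1 w = (if w = z then deriv f z else f w / (w - z))" for w
  have hol1: "g1 holomorphic_on ball z r"
    using pole_theorem[OF r(2), of z "\<lambda>w. f w / (w - z)"] r(1) 0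
    by (simp add: g1_def[abs_def] if_distrib cong: if_cong)
  define g2 where "g2 w = (if w = z then deriv g1 z else g1 w / (w - z))" for w
  have hol2: "g2 holomorphic_on ball z r"
    using pole_theorem[OF hol1, of z "\<lambda>w. g1 w / (w - z)"] r(1) 0
    by (simp add: g2_def[abs_def] g1_def cong: if_cong)
  have "f w = (w - z)^2 * g2 w" for w
    using 0 by (simp add: g1_def g2_def power2_eq_square)
  then show "root_of_mult_ge 2 f z"
    unfolding root_of_mult_ge_def using hol2 r(1) by (auto simp: analytic_on_def intro!: exI[of _ g2])
qed

lemma real_analytic_on_imp_continuous_on:
  assumes "real_analytic_on f S"
  shows "continuous_on S f"
proof (rule continuous_on_eq_continuous_within[THEN iffD2, rule_format])
  fix y assume y: "y \<in> S"
  then obtain r a where r: "r > 0"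
    and sums: "\<And>x. x \<in> S \<Longrightarrow> \<bar>x - y\<bar> < r \<Longrightarrow> (\<lambda>n. a n * of_real (x - y) ^ n) sums f x"
    using assms unfolding real_analytic_on_def by meson
  show "continuous (at y within S) f"
  proof (cases "y islimpt S")
    case False
    then show ?thesis
      by (simp add: continuous_within trivial_limit_within[symmetric] tendsto_bot)
  next
    case True
    \<comment> \<open>Convergence at a single point of \<open>S\<close> other than \<open>y\<close>
      forces a positive radius of convergence, hence continuity of the sum at the centre.\<close>
    then obtain x0 where x0: "x0 \<in> S" "x0 \<noteq> y" "dist x0 y < r"
      using r by (auto simp: islimpt_approachable)
    define P where "P = (\<lambda>z. \<Sum>n. a n * z ^ n)"
    have conv: "isCont P 0"
      unfolding P_def
      by (rule isCont_powser[where K = "of_real (x0 - y)"])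
         (use sums[OF x0(1)] x0 in \<open>auto simp: dist_real_def intro: sums_summable\<close>)
    have "((\<lambda>x. of_real (x - y) :: complex) \<longlongrightarrow> 0) (at y within S)"
      by (auto intro!: tendsto_eq_intros)
    then have "((\<lambda>x. P (of_real (x - y))) \<longlongrightarrow> P 0) (at y within S)"
      by (rule isCont_tendsto_compose[OF conv])
    moreover have eq: "f x = P (of_real (x - y))" if "x \<in> S" "\<bar>x - y\<bar> < r" for x
      using sums[OF that] by (simp add: P_def sums_iff)
    moreover have "\<forall>\<^sub>F x in at y within S. P (of_real (x - y)) = f x"
      using r eq unfolding eventually_at by (auto simp: dist_real_def)
    ultimately show ?thesis
      using y r eq[of y] Lim_transform_eventually by (simp add: continuous_within tendsto_cong)
  qed
qed

lemma norm_diff_le_mvt: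
  fixes f :: "real \<Rightarrow> 'a::euclidean_space"
  assumes "p \<le> q" "continuous_on {p..q} f"
    and df: "\<And>x. x \<in> {p<..<q} \<Longrightarrow> (f has_vector_derivative f' x) (at x)"
    and le: "\<And>x. x \<in> {p<..<q} \<Longrightarrow> norm (f' x) \<le> B"
  shows "norm (f q - f p) \<le> B * (q - p)"
proof (cases "p = q")
  case False
  then have "p < q" using assms by simp
  then obtain x where x: "x \<in> {p<..<q}" "norm (f q - f p) \<le> norm ((q - p) *\<^sub>R f' x)"
    using mvt_general[of p q f "\<lambda>x t. t *\<^sub>R f' x"] assms(2) df
    by (auto simp: has_vector_derivative_def)
  have "norm ((q - p) *\<^sub>R f' x) \<le> B * (q - p)"
    using le[OF x(1)] \<open>p < q\<close> by (simp add: mult.commute mult_right_mono)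
  with x(2) show ?thesis by linarith
qed simp

text \<open>One-sided limits see only the open cell, which suits a wave whose values at the shocks
  are unspecified.\<close>

lemma Lim_cell_endpoints:
  fixes f g :: "real \<Rightarrow> complex"
  assumes "X > 0" and cont: "continuous_on {0..X} f"
    and eq: "\<And>x. x \<in> {0<..<X} \<Longrightarrow> g x = f x"
  shows "Lim (at_left X) g = f X" "Lim (at_right 0) g = f 0"
proof -
  have "(f \<longlongrightarrow> f X) (at_left X)" "(f \<longlongrightarrow> f 0) (at_right 0)"
    using cont \<open>X > 0\<close> by (auto simp: continuous_on_def at_within_Icc_at_left[symmetric] at_within_Icc_at_right[symmetric])
  moreover have "\<forall>\<^sub>F x in at_left X. f x = g x" "\<forall>\<^sub>F x in at_right 0. f x = g x"
    by (rule eventually_at_leftI[of 0] eventually_at_rightI[of _ X]; use eq \<open>X > 0\<close> in simp)+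
  ultimately have "(g \<longlongrightarrow> f X) (at_left X)" "(g \<longlongrightarrow> f 0) (at_right 0)"
    by (auto elim: Lim_transform_eventually)
  then show "Lim (at_left X) g = f X" "Lim (at_right 0) g = f 0"
    by (auto intro: tendsto_Lim)
qed

lemma exp_ii_ne_1:
  fixes t :: real
  assumes "t \<noteq> 0" "\<bar>t\<bar> \<le> pi"
  shows "exp (\<i> * of_real t) \<noteq> 1"
proof
  assume "exp (\<i> * of_real t) = 1"
  then obtain n :: int where n: "t = of_int (2 * n) * pi" by (auto simp: exp_eq_1)
  then have "n \<noteq> 0" using assms(1) by auto
  then have "\<bar>real_of_int n\<bar> \<ge> 1" by linarith
  then have "2 * pi * 1 \<le> 2 * pi * \<bar>real_of_int n\<bar>" by (intro mult_left_mono) auto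
  then have "2 * pi \<le> \<bar>t\<bar>" using n by (simp add: abs_mult mult_ac)
  then show False using assms(2) pi_gt_zero by linarith
qed

section \<open>The profile on one cell and the coefficients of the linearization\<close>

locale roll_wave_cell =
  fixes F Hs Hm Hp X xs :: real and H0 H Q :: "real \<Rightarrow> real"
  assumes F: "F > 2" and profile: "cell_profile F Hs Hm Hp X H0"
    and xs: "xs \<in> {0<..<X}" and H0_xs: "H0 xs = Hs"
    and H_eq: "\<And>x. x \<in> {0<..<X} \<Longrightarrow> H x = H0 x"
    and Q_eq: "\<And>x. x \<in> {0<..<X} \<Longrightarrow> Q x = rw_speed F Hs * H0 x - rw_q0 F Hs"
begin

abbreviation "c \<equiv> rw_speed F Hs"
abbreviation "q0 \<equiv> rw_q0 F Hs"
abbreviation "s \<equiv> sqrt Hs"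

text \<open>The right-hand side of the profile equation, so that \<open>V (H0 x)\<close> is the
  derivative of the profile.\<close>

definition V :: "real \<Rightarrow> real" where
  "V y = F^2 * (y^2 + (Hs - c^2) * y + q0^2 / Hs) / (y^2 + Hs * y + Hs^2)"

text \<open>The source term along the profile, where \<open>Q = c * y - q0\<close>. It is also the
  linearized flux of the profile derivative, and becomes the singular coefficient that vanishes at
  the sonic height.\<close>

definition S :: "real \<Rightarrow> real" where
  "S y = y - (c * y - q0)^2 / y^2"

text \<open>\<open>\<gamma>\<close> and \<open>\<nu>\<close> are the coefficients in
  \<open>S * k' = - m * \<gamma> * k - (m + \<nu>) * u\<close> for the ratio
  \<open>k = h / V\<close>. With \<open>b = c - 2 * q0 / y\<close>, the coefficient of
  \<open>u\<close> in the flux, \<open>\<gamma>\<close> is \<open>(c - b) * V\<close>, and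
  \<open>\<nu>\<close> is \<open>2 * Q / H^2\<close> plus the derivative of \<open>b\<close> along
  the profile.\<close>

definition \<gamma> :: "real \<Rightarrow> real" where
  "\<gamma> y = 2 * q0 * V y / y"

definition \<nu> :: "real \<Rightarrow> real" where
  "\<nu> y = 2 * (c * y - q0) / y^2 + 2 * q0 * V y / y^2"

text \<open>\<open>\<beta>\<close> and \<open>U\<^sub>s\<close> encode the sonic normalization: for
  real \<open>m \<ge> 0\<close> it reads \<open>h = V Hs * (1 + m / \<beta>)\<close> and
  \<open>q - c * h = m * U\<^sub>s\<close>.\<close>

definition \<beta> :: real where "\<beta> = 2/3 * (F + 1) / s"

definition U\<^sub>s :: real where "U\<^sub>s = - Hs * (F - 2) / (F + 1)"

lemma Hs_pos: "Hs > 0" and X_pos: "X > 0" and Hm_less: "Hm < Hs"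
  using profile by (auto simp: cell_profile_def)

lemma s_pos: "s > 0" and s_sq: "Hs = s^2"
  using Hs_pos by auto

lemma q0_eq: "q0 = s^3 / F"
proof -
  have "Hs powr (3/2) = (Hs powr (1/2)) powr 3" by (simp add: powr_powr)
  also have "\<dots> = s^3" using Hs_pos by (simp add: powr_half_sqrt)
  finally show ?thesis by (simp add: rw_q0_def)
qed

lemma q0_pos: "q0 > 0"
  using q0_eq s_pos F by simp

lemma c_eq: "c = s * (F + 1) / F"
  using F by (simp add: rw_speed_def field_simps)

lemma Hm_pos: "Hm > 0"
proof -
  have "(1 + 2*F + sqrt (1 + 4*F)) / (2 * F^2) * Hs > 0"
    using F Hs_pos by (intro mult_pos_pos divide_pos_pos) (auto intro!: add_pos_nonneg)
  then show ?thesis using profile by (auto simp: cell_profile_def)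
qed

lemma V_denom_pos: "y > 0 \<Longrightarrow> y^2 + Hs * y + Hs^2 > 0"
  using Hs_pos by (intro add_pos_pos) auto

text \<open>Completing the square in the numerator of \<open>V\<close>. Its larger root is exactly
  the lower bound imposed on \<open>Hm\<close>, so \<open>V\<close> is positive on the cell.\<close>

lemma V_num_eq:
  "4 * F^4 * (y^2 + (Hs - c^2) * y + q0^2 / Hs) = (2 * F^2 * y - (1 + 2*F) * Hs)^2 - (1 + 4*F) * Hs^2"
proof -
  \<comment> \<open>With \<open>t\<close> as an atom, \<open>Hs\<close>, \<open>c\<close> and
    \<open>q0\<close> are rational in \<open>t\<close> and \<open>F\<close>, and the claim is a
    rational identity.\<close>
  define t where "t = s"
  have t: "t > 0" "Hs = t^2" "c = t * (F+1)/F" "q0 = t^3/F"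
    using s_pos s_sq c_eq q0_eq by (simp_all add: t_def)
  show ?thesis unfolding t(3,4) unfolding t(2) using t(1) F
    by (simp add: field_simps power2_eq_square power3_eq_cube power4_eq_xxxx)
qed

lemma V_pos:
  assumes "y \<ge> Hm"
  shows "V y > 0"
proof -
  have "(1 + 2*F + sqrt (1 + 4*F)) / (2 * F^2) * Hs < y"
    using profile assms by (auto simp: cell_profile_def)
  then have "sqrt (1 + 4*F) * Hs < 2 * F^2 * y - (1 + 2*F) * Hs"
    using F by (simp add: field_simps)
  then have "(sqrt (1 + 4*F) * Hs)^2 < (2 * F^2 * y - (1 + 2*F) * Hs)^2"
    using F Hs_pos by (intro power_strict_mono) auto
  then have "4 * F^4 * (y^2 + (Hs - c^2) * y + q0^2 / Hs) > 0"
    using F unfolding V_num_eq by (simp add: power_mult_distrib)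
  then have "y^2 + (Hs - c^2) * y + q0^2 / Hs > 0"
    using F by (simp add: zero_less_mult_iff)
  moreover have "y > 0" using assms Hm_pos by simp
  ultimately show ?thesis
    unfolding V_def using F V_denom_pos by (intro divide_pos_pos mult_pos_pos) auto
qed

text \<open>Since \<open>c * Hs - q0 = s^3\<close>, the cubic \<open>y^3 - (c * y - q0)^2\<close>
  has the root \<open>Hs\<close>; the remaining quadratic factor is the one in the numerator of
  \<open>V\<close>.\<close>

lemma S_eq_factored:
  assumes "y > 0"
  shows "S y = (y - Hs) * (V y * (y^2 + Hs * y + Hs^2) / (F^2 * y^2))"
proof -
  define t where "t = s"
  have t: "t > 0" "Hs = t^2" "c = t * (F+1)/F" "q0 = t^3/F"
    using s_pos s_sq c_eq q0_eq by (simp_all add: t_def)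
  have D: "y^2 + Hs * y + Hs^2 \<noteq> 0"
    using V_denom_pos[OF assms] by simp
  have "V y * (y^2 + Hs * y + Hs^2) = F^2 * (y^2 + (Hs - c^2) * y + q0^2 / Hs)"
    using D by (simp add: V_def)
  then have "V y * (y^2 + Hs * y + Hs^2) / (F^2 * y^2) = (y^2 + (Hs - c^2) * y + q0^2 / Hs) / y^2"
    using F by simp
  moreover have "S y = (y - Hs) * ((y^2 + (Hs - c^2) * y + q0^2 / Hs) / y^2)"
    unfolding S_def t(3,4) unfolding t(2) using t(1) F assms
    by (simp add: field_simps power2_eq_square power3_eq_cube)
  ultimately show ?thesis by simp
qed

text \<open>The bracket is the coefficient of \<open>h\<close> in the flux when
  \<open>q = c * h\<close>. It equals \<open>y / F^2 - q0^2 / y^2\<close>, the derivative of the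
  steady flux \<open>q0^2 / y + y^2 / (2 * F^2)\<close>, so the identity is the profile equation in
  conservative form.\<close>

lemma flux_coeff_eq:
  assumes "y > 0"
  shows "(c * (2 * (c * y - q0) / y - c) + (- ((c * y - q0)^2 / y^2) + y / F^2)) * V y = S y"
proof -
  define t where "t = s"
  have t: "t > 0" "Hs = t^2" "c = t * (F+1)/F" "q0 = t^3/F"
    using s_pos s_sq c_eq q0_eq by (simp_all add: t_def)
  have "c * (2 * (c * y - q0) / y - c) + (- ((c * y - q0)^2 / y^2) + y / F^2) =
      (y - Hs) * (y^2 + Hs * y + Hs^2) / (F^2 * y^2)"
    unfolding t(3,4) unfolding t(2) using t(1) F assms
    by (simp add: field_simps power2_eq_square power3_eq_cube)
  then show ?thesis using S_eq_factored[OF assms] by simp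
qed

text \<open>The values of \<open>\<gamma>\<close> and \<open>\<nu>\<close> give \<open>(1 + m /
  \<beta>) * \<gamma> Hs + (m + \<nu> Hs) * U\<^sub>s = 0\<close>, the cancellation of the forcing
  at the sonic point. The slope \<open>1 - 2 / F\<close> is positive because \<open>F > 2\<close>,
  so \<open>S\<close> has a simple zero at \<open>Hs\<close>.\<close>

lemma V_sonic: "V Hs = F * (F - 2) / 3"
  and \<gamma>_sonic: "\<gamma> Hs = - \<beta> * U\<^sub>s"
  and \<nu>_sonic: "\<nu> Hs = \<beta>"
  and S_deriv_sonic: "1 - 2 * (c * Hs - q0) * c / Hs^2 + 2 * (c * Hs - q0)^2 / Hs^3 = 1 - 2 / F"
proof -
  define t where "t = s"
  have t: "t > 0" "Hs = t^2" "c = t * (F+1)/F" "q0 = t^3/F" "\<beta> = 2/3 * (F + 1) / t"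
    using s_pos s_sq c_eq q0_eq by (simp_all add: t_def \<beta>_def)
  show V: "V Hs = F * (F - 2) / 3"
    unfolding V_def t(3,4) unfolding t(2) using t(1) F
    by (simp add: field_simps power2_eq_square power3_eq_cube power4_eq_xxxx)
  have "(2/3 * g / t) * (- (t^2) * (F - 2) / g) = - 2/3 * t * (F - 2)" if "g \<noteq> 0" for g
    using that t(1) by (simp add: field_simps power2_eq_square)
  from this[of "F + 1"] have "\<beta> * U\<^sub>s = - 2/3 * t * (F - 2)"
    using F unfolding U\<^sub>s_def t(5) unfolding t(2) by simp
  moreover have "\<gamma> Hs = 2/3 * t * (F - 2)"
    unfolding \<gamma>_def V t(3,4) unfolding t(2) using t(1) F
    by (simp add: field_simps power2_eq_square power3_eq_cube)
  ultimately show "\<gamma> Hs = - \<beta> * U\<^sub>s" by simp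
  show "\<nu> Hs = \<beta>"
    unfolding \<nu>_def V t(3,4,5) unfolding t(2) using t(1) F
    by (simp add: field_simps power2_eq_square power3_eq_cube)
  show "1 - 2 * (c * Hs - q0) * c / Hs^2 + 2 * (c * Hs - q0)^2 / Hs^3 = 1 - 2 / F"
    unfolding t(3,4) unfolding t(2) using t(1) F
    by (simp add: field_simps power2_eq_square power3_eq_cube)
qed

lemma H0_range: "x \<in> {0..X} \<Longrightarrow> H0 x \<in> {Hm..Hp}"
  using profile unfolding cell_profile_def by blast

lemma H0_pos: "x \<in> {0..X} \<Longrightarrow> H0 x > 0"
  using H0_range[of x] Hm_pos by auto

lemma H0_less_iff: "x \<in> {0..X} \<Longrightarrow> y \<in> {0..X} \<Longrightarrow> H0 x < H0 y \<longleftrightarrow> x < y"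
  using profile by (auto simp: cell_profile_def strict_mono_on_less)

lemma H0_has_derivative_within:
  "x \<in> {0..X} \<Longrightarrow> (H0 has_real_derivative V (H0 x)) (at x within {0..X})"
  using profile by (auto simp: cell_profile_def V_def)

lemma H0_has_derivative:
  assumes "x \<in> {0<..<X}"
  shows "(H0 has_real_derivative V (H0 x)) (at x)"
  using H0_has_derivative_within[of x] assms at_within_interior[of x "{0..X}"]
  by auto

lemma continuous_on_H0: "continuous_on {0..X} H0"
  using H0_has_derivative_within by (rule DERIV_continuous_on)

lemma continuous_on_V: "continuous_on {0<..} V"
  unfolding V_def using V_denom_pos by (intro continuous_intros) (auto simp: less_imp_neq[THEN not_sym])

lemma continuous_on_V_H0: "continuous_on {0..X} (\<lambda>x. V (H0 x))"
  using H0_pos by (intro continuous_on_compose2[OF continuous_on_V continuous_on_H0]) auto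

lemma continuous_on_S_H0: "continuous_on {0..X} (\<lambda>x. S (H0 x))"
  unfolding S_def using H0_pos by (intro continuous_intros continuous_on_H0) fastforce

lemma continuous_on_\<gamma>_H0: "continuous_on {0..X} (\<lambda>x. \<gamma> (H0 x))"
  unfolding \<gamma>_def using H0_pos by (intro continuous_intros continuous_on_H0 continuous_on_V_H0) fastforce

lemma continuous_on_\<nu>_H0: "continuous_on {0..X} (\<lambda>x. \<nu> (H0 x))"
  unfolding \<nu>_def using H0_pos by (intro continuous_intros continuous_on_H0 continuous_on_V_H0) fastforce+

lemma V_H0_differentiable:
  assumes "x \<in> {0<..<X}"
  shows "(\<lambda>x. V (H0 x)) differentiable (at x)"
proof -
  have "H0 differentiable (at x)"
    using H0_has_derivative[OF assms] real_differentiable_def by blast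
  moreover have "H0 x > 0" using assms H0_pos by auto
  ultimately show ?thesis
    unfolding V_def using V_denom_pos[of "H0 x"] by (intro derivative_intros) auto
qed

lemma \<gamma>_H0_differentiable:
  assumes "x \<in> {0<..<X}"
  shows "(\<lambda>x. \<gamma> (H0 x)) differentiable (at x)"
proof -
  have "H0 differentiable (at x)"
    using H0_has_derivative[OF assms] real_differentiable_def by blast
  moreover have "H0 x > 0" using assms H0_pos by auto
  ultimately show ?thesis
    unfolding \<gamma>_def using V_H0_differentiable[OF assms] by (intro derivative_intros) auto
qed

lemma \<nu>_H0_differentiable:
  assumes "x \<in> {0<..<X}"
  shows "(\<lambda>x. \<nu> (H0 x)) differentiable (at x)"
proof -
  have "H0 differentiable (at x)"
    using H0_has_derivative[OF assms] real_differentiable_def by blast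
  moreover have "H0 x > 0" using assms H0_pos by auto
  ultimately show ?thesis
    unfolding \<nu>_def using V_H0_differentiable[OF assms] by (intro derivative_intros) auto
qed

lemma S_has_derivative:
  "y > 0 \<Longrightarrow> (S has_real_derivative
     1 - 2 * (c * y - q0) * c / y^2 + 2 * (c * y - q0)^2 / y^3) (at y)"
  unfolding S_def by (auto intro!: derivative_eq_intros simp: field_simps power2_eq_square power3_eq_cube)

lemma S_H0_has_derivative:
  "x \<in> {0<..<X} \<Longrightarrow> ((\<lambda>x. S (H0 x)) has_real_derivative
     (1 - 2 * (c * H0 x - q0) * c / (H0 x)^2 + 2 * (c * H0 x - q0)^2 / (H0 x)^3) * V (H0 x)) (at x)"
  using DERIV_chain2[OF S_has_derivative H0_has_derivative] H0_pos by auto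

lemma S_H0_sgn:
  assumes "x \<in> {0..X}"
  shows "sgn (S (H0 x)) = sgn (x - xs)"
proof -
  have "H0 x > 0" "V (H0 x) > 0" using assms H0_pos H0_range[OF assms] V_pos by auto
  then have "V (H0 x) * ((H0 x)^2 + Hs * H0 x + Hs^2) / (F^2 * (H0 x)^2) > 0"
    using V_denom_pos F by simp
  then obtain p where "p > 0" "S (H0 x) = (H0 x - Hs) * p"
    using S_eq_factored[OF \<open>H0 x > 0\<close>] by blast
  then have "sgn (S (H0 x)) = sgn (H0 x - H0 xs)"
    using H0_xs by (simp add: sgn_mult)
  also have "\<dots> = sgn (x - xs)"
    using H0_less_iff[of x xs] H0_less_iff[of xs x] assms xs by (auto simp: sgn_if)
  finally show ?thesis .
qed

lemma S_sonic: "S Hs = 0"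
  using S_eq_factored[OF Hs_pos] by simp

text \<open>The zero at \<open>xs\<close> is simple and is the only one in the cell, so the filled
  difference quotient of \<open>S (H0 x)\<close> at \<open>xs\<close> is positive; its minimum over
  the closed cell is the constant.\<close>

lemma S_H0_lower_bound:
  obtains C where "C > 0" "\<And>x. x \<in> {0..X} \<Longrightarrow> C * \<bar>x - xs\<bar> \<le> \<bar>S (H0 x)\<bar>"
proof -
  define D where "D = (1 - 2 / F) * V Hs"
  have D: "D > 0" using F by (simp add: D_def V_sonic)
  have "((\<lambda>x. S (H0 x)) has_real_derivative D) (at xs)"
    using S_H0_has_derivative[OF xs] unfolding D_def H0_xs S_deriv_sonic .
  from slope_continuous_on[OF continuous_on_S_H0 this]
  have cont: "continuous_on {0..X} (\<lambda>x. if x = xs then D else (S (H0 x) - S (H0 xs)) / (x - xs))" .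
  obtain x0 where x0: "x0 \<in> {0..X}"
    "\<And>x. x \<in> {0..X} \<Longrightarrow> (if x0 = xs then D else (S (H0 x0) - S (H0 xs)) / (x0 - xs)) \<le>
       (if x = xs then D else (S (H0 x) - S (H0 xs)) / (x - xs))"
    using continuous_attains_inf[OF _ _ cont] X_pos by auto
  let ?C = "if x0 = xs then D else (S (H0 x0) - S (H0 xs)) / (x0 - xs)"
  have C: "?C > 0"
    using D S_H0_sgn[OF x0(1)] S_sonic H0_xs
    by (auto simp: sgn_if zero_less_divide_iff split: if_splits)
  show thesis
  proof (rule that[OF C])
    fix x assume x: "x \<in> {0..X}"
    show "?C * \<bar>x - xs\<bar> \<le> \<bar>S (H0 x)\<bar>"
    proof (cases "x = xs")
      case False
      then have "?C \<le> S (H0 x) / (x - xs)" using x0(2)[OF x] S_sonic H0_xs by simp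
      also have "\<dots> \<le> \<bar>S (H0 x)\<bar> / \<bar>x - xs\<bar>" by (metis abs_divide abs_ge_self)
      finally show ?thesis using False by (simp add: pos_le_divide_eq)
    qed simp
  qed
qed

section \<open>The interior equations near the sonic point\<close>

text \<open>Substituting \<open>q = u + c * h\<close> concentrates the degeneracy in a single term,
  since by \<open>flux_coeff_eq\<close> the coefficient of \<open>h\<close> becomes
  \<open>S / V\<close>.\<close>

lemma lin_flux_eq:
  assumes "x \<in> {0<..<X}"
  shows "lin_flux F c H Q h q x =
    (c - 2 * q0 / H0 x) *\<^sub>R (q x - of_real c * h x) + (S (H0 x) / V (H0 x)) *\<^sub>R h x"
proof -
  have x: "x \<in> {0..X}" using assms by auto
  have pos: "H0 x > 0" "V (H0 x) > 0" using H0_pos[OF x] H0_range[OF x] V_pos by auto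
  let ?b = "2 * (c * H0 x - q0) / H0 x - c"
  let ?e = "- ((c * H0 x - q0)^2 / (H0 x)^2) + H0 x / F^2"
  have b: "c - 2 * q0 / H0 x = ?b" using pos by (simp add: field_simps)
  have a: "S (H0 x) / V (H0 x) = c * ?b + ?e"
    unfolding flux_coeff_eq[OF pos(1), symmetric] using pos(2) by simp
  have split: "of_real b * q x + of_real e * h x =
      of_real b * (q x - of_real c * h x) + of_real (c * b + e) * h x" for b e :: real
    by (simp add: algebra_simps)
  have "lin_flux F c H Q h q x = of_real ?b * q x + of_real ?e * h x"
    unfolding lin_flux_def H_eq[OF assms] Q_eq[OF assms] by simp
  also have "\<dots> = of_real ?b * (q x - of_real c * h x) + of_real (c * ?b + ?e) * h x"
    by (rule split)
  finally show ?thesis unfolding a b by (simp add: scaleR_conv_of_real)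
qed

text \<open>
  The derivative \<open>H'\<close> solves the interior equations at \<open>\<mu> = 0\<close>. In terms of the ratio
  \<open>k = h / H'\<close> the momentum equation therefore has no zeroth-order term in \<open>k\<close> at \<open>\<mu> = 0\<close>.
\<close>

lemma ratio_ode:
  assumes sol: "interior_solution F c X H Q (of_real m) h q"
    and x: "x \<in> {0<..<X}" "x \<noteq> xs"
  defines "k \<equiv> \<lambda>x. h x /\<^sub>R V (H0 x)" and "u \<equiv> \<lambda>x. q x - of_real c * h x"
  shows "\<exists>k'. (k has_vector_derivative k') (at x) \<and>
    S (H0 x) *\<^sub>R k' = - (m * \<gamma> (H0 x)) *\<^sub>R k x - (m + \<nu> (H0 x)) *\<^sub>R u x"
proof -
  have xX: "x \<in> {0..X}" using x by auto
  define y where "y = H0 x"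
  have pos: "y > 0" "V y > 0" using H0_pos[OF xX] H0_range[OF xX] V_pos by (auto simp: y_def)
  have S0: "S y \<noteq> 0" using S_H0_sgn[OF xX] x(2) by (auto simp: y_def sgn_if split: if_splits)
  define A where "A = 2 * (c * y - q0) / y^2"
  define B where "B = 2 * (c * y - q0)^2 / y^3"
  define b where "b x = c - 2 * q0 / H0 x" for x
  define b' where "b' = 2 * q0 * V y / y^2"
  define v where "v = lin_flux F c H Q h q"
  define v' where "v' = h x - of_real A * q x + of_real B * h x - of_real m * q x"
  define S' where "S' = (1 - A * c + B) * V y"
  have du: "(u has_vector_derivative - (of_real m * h x)) (at x)"
    using sol x(1) by (simp add: interior_solution_def u_def algebra_simps)
  have dv: "(v has_vector_derivative v') (at x)"
    using sol x(1) by (simp add: interior_solution_def v_def v'_def A_def B_def y_def H_eq Q_eq)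
  have db: "(b has_real_derivative b') (at x)"
    unfolding b_def b'_def y_def using H0_has_derivative[OF x(1)] H0_pos[OF xX]
    by (auto intro!: derivative_eq_intros simp: field_simps power2_eq_square)
  have dS: "((\<lambda>x. S (H0 x)) has_real_derivative S') (at x)"
    using S_H0_has_derivative[OF x(1)] by (simp add: S'_def A_def B_def y_def algebra_simps)
  have dinv: "((\<lambda>x. inverse (S (H0 x))) has_real_derivative - (inverse (S y) * S' * inverse (S y))) (at x)"
    using DERIV_inverse'[OF dS] S0 by (simp add: y_def)
  \<comment> \<open>The equations provide derivatives of \<open>u\<close> and of the flux
    \<open>v\<close>, so \<open>k\<close> is differentiated as \<open>(v - b * u) / S\<close>, which
    is legitimate away from the sonic point.\<close>
  define k' where "k' = inverse (S y) *\<^sub>R (v' - (b x *\<^sub>R - (of_real m * h x) + b' *\<^sub>R u x)) +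
     (- (inverse (S y) * S' * inverse (S y))) *\<^sub>R (v x - b x *\<^sub>R u x)"
  have dk0: "((\<lambda>x. inverse (S (H0 x)) *\<^sub>R (v x - b x *\<^sub>R u x)) has_vector_derivative k') (at x)"
    unfolding k'_def y_def
    by (intro has_vector_derivative_scaleR has_vector_derivative_diff dv dinv[unfolded y_def]
        has_vector_derivative_scaleR db du)
  have k_eq: "inverse (S (H0 z)) *\<^sub>R (v z - b z *\<^sub>R u z) = k z"
    if z: "z \<in> {0<..<X} - {xs}" for z
  proof -
    have zX: "z \<in> {0..X}" using z by auto
    have "S (H0 z) \<noteq> 0" using S_H0_sgn[OF zX] z by (auto simp: sgn_if split: if_splits)
    then show ?thesis
      using z by (simp add: v_def lin_flux_eq b_def u_def k_def divide_inverse)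
  qed
  have dk: "(k has_vector_derivative k') (at x)"
    by (rule has_vector_derivative_transform_within_open[OF dk0, where S = "{0<..<X} - {xs}"])
       (use x k_eq in auto)
  have "v x - b x *\<^sub>R u x = S y *\<^sub>R (inverse (S y) *\<^sub>R (v x - b x *\<^sub>R u x))"
    using S0 by simp
  also have "inverse (S y) *\<^sub>R (v x - b x *\<^sub>R u x) = k x"
    using k_eq[of x] x by (simp add: y_def)
  finally have vx: "v x - b x *\<^sub>R u x = S y *\<^sub>R k x" .
  have hx: "h x = V y *\<^sub>R k x" using pos by (simp add: k_def y_def)
  have qx: "q x = u x + of_real c * (V y *\<^sub>R k x)" by (simp add: u_def flip: hx)
  have "S y *\<^sub>R k' = (v' + b x *\<^sub>R (of_real m * h x) - b' *\<^sub>R u x) - S' *\<^sub>R k x"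
    unfolding k'_def vx using S0 by (simp add: algebra_simps) (simp add: field_simps)
  \<comment> \<open>The terms in \<open>k\<close> without a factor \<open>m\<close> cancel: the
    source contributes \<open>(1 - A * c + B) * V y\<close>, which is \<open>S'\<close>.\<close>
  also have "\<dots> = (m * ((b x - c) * V y)) *\<^sub>R k x - (m + (A + b')) *\<^sub>R u x"
    unfolding v'_def qx hx S'_def by (simp add: scaleR_conv_of_real algebra_simps)
  also have "(b x - c) * V y = - \<gamma> (H0 x)"
    by (simp add: b_def \<gamma>_def y_def)
  also have "A + b' = \<nu> (H0 x)"
    by (simp add: A_def b'_def \<nu>_def y_def)
  finally show ?thesis using dk by (auto simp: y_def)
qed

lemma \<beta>_pos: "\<beta> > 0"
  using F s_pos by (simp add: \<beta>_def)

lemma V_H0_pos: "x \<in> {0..X} \<Longrightarrow> V (H0 x) > 0"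
  using H0_range[of x] V_pos by auto

lemma V_H0_bounded:
  obtains C where "C > 0" "\<And>x. x \<in> {0..X} \<Longrightarrow> V (H0 x) \<le> C"
proof -
  have "compact ((\<lambda>x. V (H0 x)) ` {0..X})"
    by (intro compact_continuous_image continuous_on_V_H0) auto
  then obtain C where C: "C > 0" "\<forall>y\<in>(\<lambda>x. V (H0 x)) ` {0..X}. norm y \<le> C"
    using compact_imp_bounded bounded_pos by blast
  show thesis by (rule that[OF C(1)]) (use C(2) in \<open>auto simp: abs_le_iff\<close>)
qed

text \<open>
  The singular equation is damped on both sides of the sonic point (the coefficient of \<open>k\<close> and
  \<open>S (H0 x) / (x - xs)\<close> are positive), and by the normalization at the sonic point its forcing
  vanishes there to first order, like \<open>S\<close>.
\<close>

lemma ratio_bound: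
  obtains M where "M \<ge> 0"
    "\<And>m h q x. \<lbrakk>0 < m; m \<le> 1; continuous_on {0..X} h; continuous_on {0..X} q;
       interior_solution F c X H Q (of_real m) h q;
       h xs = of_real (V Hs * (1 + m / \<beta>)); q xs - of_real c * h xs = of_real (m * U\<^sub>s);
       x \<in> {0..X}\<rbrakk> \<Longrightarrow>
     norm (h x /\<^sub>R V (H0 x) - of_real (1 + m / \<beta>)) \<le> M * m"
proof -
  obtain C1 where C1: "C1 > 0" "\<And>x. x \<in> {0..X} \<Longrightarrow> \<bar>\<gamma> (H0 x) - \<gamma> (H0 xs)\<bar> \<le> C1 * \<bar>x - xs\<bar>"
    using slope_bounded[OF continuous_on_\<gamma>_H0 \<gamma>_H0_differentiable[OF xs]] by metis
  obtain C2 where C2: "C2 > 0" "\<And>x. x \<in> {0..X} \<Longrightarrow> \<bar>\<nu> (H0 x) - \<nu> (H0 xs)\<bar> \<le> C2 * \<bar>x - xs\<bar>"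
    using slope_bounded[OF continuous_on_\<nu>_H0 \<nu>_H0_differentiable[OF xs]] by metis
  obtain C3 where C3: "C3 > 0" "\<And>x. x \<in> {0..X} \<Longrightarrow> C3 * \<bar>x - xs\<bar> \<le> \<bar>S (H0 x)\<bar>"
    using S_H0_lower_bound by metis
  obtain CV where CV: "CV > 0" "\<And>x. x \<in> {0..X} \<Longrightarrow> V (H0 x) \<le> CV"
    using V_H0_bounded by metis
  \<comment> \<open>For \<open>m \<le> 1\<close>, \<open>K0\<close> bounds the sonic value
    \<open>1 + m / \<beta>\<close> and \<open>Cn\<close> bounds \<open>m + \<nu>\<close> in modulus.
    \<open>D\<close> collects the three pieces of the forcing, and division by \<open>C3\<close>
    trades the distance to the sonic point for \<open>S\<close>.\<close>
  define K0 where "K0 = 1 + 1 / \<beta>"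
  define Cn where "Cn = 1 + \<beta> + C2 * X"
  define D where "D = K0 * C1 + C2 * \<bar>U\<^sub>s\<bar> + Cn * CV * K0"
  define C where "C = D / C3"
  have K0: "K0 \<ge> 1" using \<beta>_pos by (simp add: K0_def)
  have Cn: "Cn > 0" using \<beta>_pos C2(1) X_pos by (simp add: Cn_def add_pos_pos)
  have D: "D \<ge> 0" using K0 Cn C1(1) C2(1) CV(1) by (simp add: D_def)
  have C: "C \<ge> 0" using D C3(1) by (simp add: C_def)
  show thesis
  proof (rule that[of "C * exp ((1 + C) * X)"])
    show "C * exp ((1 + C) * X) \<ge> 0" using C by simp
    fix m :: real and h q :: "real \<Rightarrow> complex" and x :: real
    assume m: "0 < m" "m \<le> 1"
      and cont_h: "continuous_on {0..X} h" and cont_q: "continuous_on {0..X} q"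
      and sol: "interior_solution F c X H Q (of_real m) h q"
      and h_xs: "h xs = of_real (V Hs * (1 + m / \<beta>))"
      and u_xs: "q xs - of_real c * h xs = of_real (m * U\<^sub>s)"
      and x: "x \<in> {0..X}"
    define ks where "ks = 1 + m / \<beta>"
    have ks: "\<bar>ks\<bar> \<le> K0" using m \<beta>_pos by (simp add: ks_def K0_def field_simps)
    define k where "k x = h x /\<^sub>R V (H0 x)" for x
    define u where "u x = q x - of_real c * h x" for x
    \<comment> \<open>The side of the sonic point containing \<open>x\<close> is parametrized by its
      distance from \<open>xs\<close>; the sign \<open>\<sigma>\<close> makes
      \<open>\<sigma> * S\<close> positive on either side.\<close>
    define \<sigma> :: real where "\<sigma> = (if x \<ge> xs then 1 else -1)"
    define T where "T = (if x \<ge> xs then X - xs else xs)"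
    define p where "p y = xs + \<sigma> * y" for y
    define w where "w y = k (p y) - of_real ks" for y
    \<comment> \<open>The forcing that remains after the constant \<open>ks\<close> is subtracted
      from \<open>k\<close> and a factor \<open>m\<close> is taken out; \<open>u\<close> is itself
      of size \<open>m\<close>.\<close>
    define g where "g y = \<gamma> (H0 (p y)) *\<^sub>R of_real ks + (m + \<nu> (H0 (p y))) *\<^sub>R (u (p y) /\<^sub>R m)" for y
    have \<sigma>: "\<sigma> * \<sigma> = 1" "\<bar>\<sigma>\<bar> = 1" by (auto simp: \<sigma>_def)
    have p_in: "p y \<in> {0..X}" if "y \<in> {0..T}" for y
      using that xs by (auto simp: p_def \<sigma>_def T_def split: if_splits)
    have p_in': "p y \<in> {0<..<X}" "p y \<noteq> xs" if "y \<in> {0<..<T}" for y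
      using that xs by (auto simp: p_def \<sigma>_def T_def split: if_splits)
    have p_dist: "\<bar>p y - xs\<bar> = y" if "y \<in> {0..T}" for y
      using that by (auto simp: p_def \<sigma>_def)
    have cont_p: "continuous_on {0..T} p" unfolding p_def by (intro continuous_intros)
    have dp: "(p has_vector_derivative \<sigma>) (at y)" for y
      unfolding p_def by (auto intro!: derivative_eq_intros simp: has_real_derivative_iff_has_vector_derivative[symmetric])
    have cont_k: "continuous_on {0..X} k"
      unfolding k_def by (intro continuous_intros cont_h continuous_on_V_H0)
        (use V_H0_pos in fastforce)
    have cont_w: "continuous_on {0..T} w"
      unfolding w_def by (intro continuous_intros continuous_on_compose2[OF cont_k cont_p])
        (use p_in in auto)
    have w0: "w 0 = 0"
      using V_pos[of Hs] Hm_less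
      by (simp add: w_def k_def p_def h_xs[folded ks_def] H0_xs scaleR_conv_of_real flip: mult.assoc)
    have S_pos: "\<sigma> * S (H0 (p y)) = \<bar>S (H0 (p y))\<bar>" "\<bar>S (H0 (p y))\<bar> > 0" if y: "y \<in> {0<..<T}" for y
    proof -
      have "sgn (S (H0 (p y))) = sgn (\<sigma> * y)"
        using S_H0_sgn[of "p y"] p_in'[OF y] by (simp add: p_def)
      then show "\<sigma> * S (H0 (p y)) = \<bar>S (H0 (p y))\<bar>" "\<bar>S (H0 (p y))\<bar> > 0"
        using y by (auto simp: \<sigma>_def sgn_if split: if_splits)
    qed
    have "norm (w \<bar>x - xs\<bar>) \<le> m * C * exp ((1 + C) * T)"
    proof (rule damped_singular_bound[where g = g and S = "\<lambda>y. \<sigma> * S (H0 (p y))" and \<gamma> = "\<lambda>y. \<gamma> (H0 (p y))"])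
      show "\<exists>w'. (w has_vector_derivative w') (at y) \<and>
          (\<sigma> * S (H0 (p y))) *\<^sub>R w' = - (m * \<gamma> (H0 (p y))) *\<^sub>R w y - m *\<^sub>R g y"
        if y: "y \<in> {0<..<T}" for y
      proof -
        obtain k' where dk: "(k has_vector_derivative k') (at (p y))"
          and eq: "S (H0 (p y)) *\<^sub>R k' =
            - (m * \<gamma> (H0 (p y))) *\<^sub>R k (p y) - (m + \<nu> (H0 (p y))) *\<^sub>R u (p y)"
          using ratio_ode[OF sol p_in'[OF y]] unfolding k_def[abs_def] u_def[abs_def] by blast
        have "(w has_vector_derivative \<sigma> *\<^sub>R k') (at y)"
          using vector_diff_chain_at[OF dp dk] unfolding w_def o_def
          by (auto intro!: derivative_eq_intros)
        moreover have "(\<sigma> * S (H0 (p y))) *\<^sub>R (\<sigma> *\<^sub>R k') = (\<sigma> * \<sigma>) *\<^sub>R (S (H0 (p y)) *\<^sub>R k')"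
          by (simp add: mult_ac)
        moreover have "\<dots> = - (m * \<gamma> (H0 (p y))) *\<^sub>R w y - m *\<^sub>R g y"
          unfolding \<sigma> eq w_def g_def using m(1) by (simp add: algebra_simps)
        ultimately show ?thesis by metis
      qed
      show "\<gamma> (H0 (p y)) \<ge> 0" if y: "y \<in> {0<..<T}" for y
        using V_H0_pos[of "p y"] H0_pos[of "p y"] p_in'[OF y] q0_pos by (simp add: \<gamma>_def)
      show "norm (g y) \<le> C * (\<sigma> * S (H0 (p y))) * (1 + B)"
        if y: "y \<in> {0<..<T}" and B: "\<And>z. z \<in> {0..y} \<Longrightarrow> norm (w z) \<le> B" for y B
      proof -
        have y': "y \<in> {0..T}" using y by auto
        have B0: "B \<ge> 0" using B[of 0] y w0 by auto
        \<comment> \<open>From \<open>u' = - m * h\<close> and \<open>h = V * (w + ks)\<close>, the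
          quotient \<open>u / m\<close> departs from its sonic value by at most \<open>y\<close>
          times a bound of \<open>h\<close>.\<close>
        have "norm (u (p y) /\<^sub>R m - u (p 0) /\<^sub>R m) \<le> CV * (K0 + B) * (y - 0)"
        proof (rule norm_diff_le_mvt)
          show "continuous_on {0..y} (\<lambda>y. u (p y) /\<^sub>R m)"
            unfolding u_def using m(1) y p_in
            by (intro continuous_intros continuous_on_compose2[OF cont_h] continuous_on_compose2[OF cont_q]
                continuous_on_subset[OF cont_p]) auto
          show "((\<lambda>y. u (p y) /\<^sub>R m) has_vector_derivative - \<sigma> *\<^sub>R h (p z)) (at z)"
            if z: "z \<in> {0<..<y}" for z
          proof -
            have "p z \<in> {0<..<X}" using p_in'[of z] z y by auto
            have cancel: "of_real m * (inverse (of_real m) * a) = a" for a :: complex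
              using m(1) by (simp flip: mult.assoc)
            from \<open>p z \<in> {0<..<X}\<close> have "(u has_vector_derivative - (of_real m * h (p z))) (at (p z))"
              using sol by (simp add: interior_solution_def u_def[abs_def] algebra_simps)
            from has_vector_derivative_scaleR[OF DERIV_const vector_diff_chain_at[OF dp this], of "inverse m"]
            show ?thesis using m(1) by (simp add: o_def scaleR_conv_of_real mult_ac cancel)
          qed
          show "norm (- \<sigma> *\<^sub>R h (p z)) \<le> CV * (K0 + B)" if z: "z \<in> {0<..<y}" for z
          proof -
            have pz: "p z \<in> {0..X}" using p_in[of z] z y by auto
            have hpz: "h (p z) = V (H0 (p z)) *\<^sub>R (w z + of_real ks)"
              using V_H0_pos[OF pz] by (simp add: w_def k_def)
            have "norm (- \<sigma> *\<^sub>R h (p z)) = norm (h (p z))" using \<sigma> by simp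
            also have "\<dots> = V (H0 (p z)) * norm (w z + of_real ks)"
              using V_H0_pos[OF pz] unfolding hpz by simp
            also have "\<dots> \<le> CV * (K0 + B)"
              using CV(2)[OF pz] CV(1) B[of z] z ks norm_triangle_ineq[of "w z" "of_real ks"]
              by (intro mult_mono) auto
            finally show ?thesis .
          qed
        qed (use y in auto)
        moreover have "u (p 0) /\<^sub>R m = of_real U\<^sub>s"
          using u_xs m(1) by (simp add: u_def p_def scaleR_conv_of_real)
        ultimately have dU: "norm (u (p y) /\<^sub>R m - of_real U\<^sub>s) \<le> CV * (K0 + B) * y" by simp
        have "\<bar>\<nu> (H0 (p y)) - \<beta>\<bar> \<le> C2 * y"
          using C2(2)[OF p_in[OF y']] p_dist[OF y'] by (simp add: H0_xs \<nu>_sonic)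
        moreover have "C2 * y \<le> C2 * X" using C2(1) y xs by (auto simp: T_def split: if_splits)
        ultimately have d\<nu>: "\<bar>\<nu> (H0 (p y)) - \<beta>\<bar> \<le> C2 * y" "\<bar>m + \<nu> (H0 (p y))\<bar> \<le> Cn"
          using m \<beta>_pos by (auto simp: Cn_def)
        have d\<gamma>: "\<bar>\<gamma> (H0 (p y)) - \<gamma> Hs\<bar> \<le> C1 * y"
          using C1(2)[OF p_in[OF y']] p_dist[OF y'] by (simp add: H0_xs)
        \<comment> \<open>The forcing at the sonic point is zero. Subtracting it from
          \<open>g y\<close> leaves three differences, each bounded by a multiple of
          \<open>y\<close>.\<close>
        have "ks * \<gamma> Hs + (m + \<beta>) * U\<^sub>s = 0"
          using \<beta>_pos by (simp add: ks_def \<gamma>_sonic field_simps)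
        then have "of_real (ks * \<gamma> Hs + (m + \<beta>) * U\<^sub>s) = (0 :: complex)" by (simp only: of_real_0)
        then have "g y = of_real (ks * (\<gamma> (H0 (p y)) - \<gamma> Hs)) + of_real ((\<nu> (H0 (p y)) - \<beta>) * U\<^sub>s) +
            (m + \<nu> (H0 (p y))) *\<^sub>R (u (p y) /\<^sub>R m - of_real U\<^sub>s)"
          unfolding g_def by (simp add: scaleR_conv_of_real algebra_simps)
        also have "norm \<dots> \<le> norm (of_real (ks * (\<gamma> (H0 (p y)) - \<gamma> Hs)) :: complex)
            + norm (of_real ((\<nu> (H0 (p y)) - \<beta>) * U\<^sub>s) :: complex)
            + norm ((m + \<nu> (H0 (p y))) *\<^sub>R (u (p y) /\<^sub>R m - of_real U\<^sub>s))"
          by (meson add_right_mono norm_triangle_ineq order_trans)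
        also have "\<dots> \<le> K0 * (C1 * y) + C2 * y * \<bar>U\<^sub>s\<bar> + Cn * (CV * (K0 + B) * y)"
          unfolding norm_of_real norm_scaleR abs_mult
          using ks d\<gamma> d\<nu> dU K0 Cn by (intro add_mono mult_mono) auto
        also have "\<dots> \<le> D * y * (1 + B)"
        proof -
          \<comment> \<open>Because \<open>K0 \<ge> 1\<close>, the sum \<open>K0 + B\<close> is at
            most \<open>K0 * (1 + B)\<close>.\<close>
          have "0 \<le> y * (K0 * C1 + C2 * \<bar>U\<^sub>s\<bar>) * B + y * Cn * CV * (K0 - 1) * B"
            using y K0 C1(1) C2(1) Cn CV(1) B0 by (intro add_nonneg_nonneg mult_nonneg_nonneg) auto
          then show ?thesis by (simp add: D_def algebra_simps)
        qed
        also have "\<dots> = C * (C3 * y) * (1 + B)" using C3(1) by (simp add: C_def)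
        also have "\<dots> \<le> C * (\<sigma> * S (H0 (p y))) * (1 + B)"
          using C3(2)[OF p_in[OF y']] p_dist[OF y'] S_pos[OF y] C B0
          by (intro mult_right_mono mult_left_mono) auto
        finally show ?thesis .
      qed
      show "\<bar>x - xs\<bar> \<in> {0..T}" using x by (auto simp: T_def)
    qed (use cont_w w0 S_pos m C in auto)
    also have "\<dots> \<le> m * C * exp ((1 + C) * X)"
      using m C xs by (intro mult_left_mono) (auto simp: T_def intro!: mult_left_mono)
    also have "p \<bar>x - xs\<bar> = x" by (auto simp: p_def \<sigma>_def)
    then have "w \<bar>x - xs\<bar> = h x /\<^sub>R V (H0 x) - of_real (1 + m / \<beta>)"
      by (simp add: w_def k_def ks_def)
    finally show "norm (h x /\<^sub>R V (H0 x) - of_real (1 + m / \<beta>)) \<le> C * exp ((1 + C) * X) * m"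
      by (simp add: mult_ac)
  qed
qed

section \<open>First-order expansion for small positive spectral parameter\<close>

text \<open>The derivative of \<open>u / m + H0\<close> is \<open>V (H0) - h\<close>, which is of
  size \<open>m\<close> by \<open>ratio_bound\<close>. Hence this function stays within order
  \<open>m\<close> of its sonic value \<open>U\<^sub>s + Hs\<close>, the constant \<open>K\<close>
  of the overview.\<close>

lemma perturbation_bound:
  obtains M where "M \<ge> 0"
    "\<And>m h q x. \<lbrakk>0 < m; m \<le> 1; continuous_on {0..X} h; continuous_on {0..X} q;
       interior_solution F c X H Q (of_real m) h q;
       h xs = of_real (V Hs * (1 + m / \<beta>)); q xs - of_real c * h xs = of_real (m * U\<^sub>s);
       x \<in> {0..X}\<rbrakk> \<Longrightarrow>
     norm (h x - of_real (V (H0 x))) \<le> M * m \<and>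
     norm ((q x - of_real c * h x) /\<^sub>R m + of_real (H0 x) - of_real (U\<^sub>s + Hs)) \<le> M * m"
proof -
  obtain M0 where M0: "M0 \<ge> 0"
    "\<And>m h q x. \<lbrakk>0 < m; m \<le> 1; continuous_on {0..X} h; continuous_on {0..X} q;
       interior_solution F c X H Q (of_real m) h q;
       h xs = of_real (V Hs * (1 + m / \<beta>)); q xs - of_real c * h xs = of_real (m * U\<^sub>s);
       x \<in> {0..X}\<rbrakk> \<Longrightarrow>
     norm (h x /\<^sub>R V (H0 x) - of_real (1 + m / \<beta>)) \<le> M0 * m"
    using ratio_bound by blast
  obtain CV where CV: "CV > 0" "\<And>x. x \<in> {0..X} \<Longrightarrow> V (H0 x) \<le> CV"
    using V_H0_bounded by metis
  \<comment> \<open>The ratio bound is multiplied by \<open>V\<close>, and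
    \<open>1 / \<beta>\<close> pays for replacing \<open>1 + m / \<beta>\<close> by
    \<open>1\<close>. The later factor \<open>1 + X\<close> covers both this bound and its integral
    over the cell.\<close>
  define M1 where "M1 = CV * (M0 + 1 / \<beta>)"
  have M1: "M1 \<ge> 0" using CV(1) M0(1) \<beta>_pos by (simp add: M1_def)
  show thesis
  proof (rule that[of "M1 * (1 + X)"])
    show "M1 * (1 + X) \<ge> 0" using M1 X_pos by simp
    fix m :: real and h q :: "real \<Rightarrow> complex" and x :: real
    assume m: "0 < m" "m \<le> 1"
      and cont_h: "continuous_on {0..X} h" and cont_q: "continuous_on {0..X} q"
      and sol: "interior_solution F c X H Q (of_real m) h q"
      and h_xs: "h xs = of_real (V Hs * (1 + m / \<beta>))"
      and u_xs: "q xs - of_real c * h xs = of_real (m * U\<^sub>s)"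
      and x: "x \<in> {0..X}"
    have h_le: "norm (h z - of_real (V (H0 z))) \<le> M1 * m" if z: "z \<in> {0..X}" for z
    proof -
      have "h z - of_real (V (H0 z)) =
          V (H0 z) *\<^sub>R ((h z /\<^sub>R V (H0 z) - of_real (1 + m / \<beta>)) + of_real (m / \<beta>))"
        using V_H0_pos[OF z] by (simp add: scaleR_conv_of_real algebra_simps)
      also have "norm \<dots> = V (H0 z) * norm ((h z /\<^sub>R V (H0 z) - of_real (1 + m / \<beta>)) + of_real (m / \<beta>))"
        using V_H0_pos[OF z] by (simp only: norm_scaleR abs_of_pos)
      also have "\<dots> \<le> CV * (M0 * m + m / \<beta>)"
      proof (intro mult_mono)
        have "norm (of_real (m / \<beta>) :: complex) = m / \<beta>" using m \<beta>_pos by (simp only: norm_of_real) simp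
        then show "norm ((h z /\<^sub>R V (H0 z) - of_real (1 + m / \<beta>)) + of_real (m / \<beta>)) \<le> M0 * m + m / \<beta>"
          using norm_triangle_ineq[of "h z /\<^sub>R V (H0 z) - of_real (1 + m / \<beta>)" "of_real (m / \<beta>)"]
            M0(2)[OF m cont_h cont_q sol h_xs u_xs z] by linarith
      qed (use CV z in auto)
      finally show ?thesis by (simp add: M1_def algebra_simps)
    qed
    define \<phi> where "\<phi> z = (q z - of_real c * h z) /\<^sub>R m + of_real (H0 z)" for z
    have cont_\<phi>: "continuous_on {0..X} \<phi>"
      unfolding \<phi>_def using m(1) by (intro continuous_intros cont_h cont_q continuous_on_H0)
    have d\<phi>: "(\<phi> has_vector_derivative - (h z - of_real (V (H0 z)))) (at z)" if z: "z \<in> {0<..<X}" for z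
    proof -
      have "((\<lambda>z. q z - of_real c * h z) has_vector_derivative - (of_real m * h z)) (at z)"
        using sol z by (simp add: interior_solution_def algebra_simps)
      from has_vector_derivative_scaleR[OF DERIV_const this, of "inverse m"]
      have "((\<lambda>z. (q z - of_real c * h z) /\<^sub>R m) has_vector_derivative - h z) (at z)"
        using m(1) by (simp add: scaleR_conv_of_real flip: mult.assoc)
      moreover have "((\<lambda>z. of_real (H0 z) :: complex) has_vector_derivative of_real (V (H0 z))) (at z)"
        using has_vector_derivative_of_real H0_has_derivative[OF z] by blast
      ultimately show ?thesis
        unfolding \<phi>_def by (auto intro: has_vector_derivative_eq_rhs[OF has_vector_derivative_add])
    qed
    have "norm (\<phi> x - \<phi> xs) \<le> M1 * m * \<bar>x - xs\<bar>"
    proof (cases "x \<ge> xs")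
      case True
      then show ?thesis
        using norm_diff_le_mvt[of xs x \<phi> "\<lambda>z. - (h z - of_real (V (H0 z)))" "M1 * m"] xs x
          d\<phi> h_le continuous_on_subset[OF cont_\<phi>] by (auto simp: norm_minus_commute)
    next
      case False
      then show ?thesis
        using norm_diff_le_mvt[of x xs \<phi> "\<lambda>z. - (h z - of_real (V (H0 z)))" "M1 * m"] xs x
          d\<phi> h_le continuous_on_subset[OF cont_\<phi>] by (auto simp: norm_minus_commute)
    qed
    also have "\<dots> \<le> M1 * m * X" using M1 m x xs by (intro mult_left_mono) auto
    also have "\<phi> xs = of_real (U\<^sub>s + Hs)"
      using u_xs m(1) H0_xs by (simp add: \<phi>_def scaleR_conv_of_real)
    finally have "norm (\<phi> x - of_real (U\<^sub>s + Hs)) \<le> M1 * m * X" .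
    moreover have "M1 * m * X \<le> M1 * (1 + X) * m" "M1 * m \<le> M1 * (1 + X) * m"
      using M1 m X_pos by (simp_all add: algebra_simps)
    ultimately show "norm (h x - of_real (V (H0 x))) \<le> M1 * (1 + X) * m \<and>
       norm ((q x - of_real c * h x) /\<^sub>R m + of_real (H0 x) - of_real (U\<^sub>s + Hs)) \<le> M1 * (1 + X) * m"
      using h_le[OF x] unfolding \<phi>_def by linarith
  qed
qed

section \<open>The determinant in terms of endpoint values\<close>

lemma H0_ends: "H0 0 = Hm" "H0 X = Hp"
  using profile by (auto simp: cell_profile_def)

text \<open>Once \<open>lin_flux_eq\<close> expresses the flux through \<open>u\<close> and
  \<open>h\<close>, every limit at a shock is the endpoint value of a function continuous on the
  closed cell. The jump of \<open>Q\<close> is \<open>c\<close> times that of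
  \<open>H\<close>.\<close>

lemma evans_lopatinsky_eq:
  assumes "continuous_on {0..X} (h \<mu>)" "continuous_on {0..X} (q \<mu>)"
  defines "u \<equiv> \<lambda>x. q \<mu> x - of_real c * h \<mu> x"
  defines "v \<equiv> \<lambda>x. (c - 2 * q0 / H0 x) *\<^sub>R u x + (S (H0 x) / V (H0 x)) *\<^sub>R h \<mu> x"
  shows "evans_lopatinsky F c X H Q h q \<mu> \<xi> =
    \<mu> * of_real (Hp - Hm) * (v X - exp (\<i> * of_real (\<xi> * X)) * v 0) -
    (\<mu> * of_real (c * (Hp - Hm)) - of_real (S Hp - S Hm)) *
      (u X - exp (\<i> * of_real (\<xi> * X)) * u 0)"
proof -
  note cont = continuous_intros assms(1,2) continuous_on_H0 continuous_on_S_H0 continuous_on_V_H0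
  have nz: "\<forall>x\<in>{0..X}. H0 x \<noteq> 0" "\<forall>x\<in>{0..X}. V (H0 x) \<noteq> 0"
    using H0_pos V_H0_pos by fastforce+
  have 1: "Lim (at_left X) (\<lambda>x. \<mu> * of_real (H x)) = \<mu> * of_real Hp"
    "Lim (at_right 0) (\<lambda>x. \<mu> * of_real (H x)) = \<mu> * of_real Hm"
    using Lim_cell_endpoints[OF X_pos, of "\<lambda>x. \<mu> * of_real (H0 x)" "\<lambda>x. \<mu> * of_real (H x)"]
    by (simp_all add: H0_ends H_eq cont)
  have 2: "Lim (at_left X) (\<lambda>x. \<mu> * of_real (Q x) - of_real (H x - (Q x)^2 / (H x)^2)) =
       \<mu> * of_real (c * Hp - q0) - of_real (S Hp)"
    "Lim (at_right 0) (\<lambda>x. \<mu> * of_real (Q x) - of_real (H x - (Q x)^2 / (H x)^2)) =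
       \<mu> * of_real (c * Hm - q0) - of_real (S Hm)"
    using Lim_cell_endpoints[OF X_pos, of "\<lambda>x. \<mu> * of_real (c * H0 x - q0) - of_real (S (H0 x))"
        "\<lambda>x. \<mu> * of_real (Q x) - of_real (H x - (Q x)^2 / (H x)^2)"]
    by (simp_all add: H0_ends H_eq Q_eq S_def[symmetric] cont del: of_real_diff)
  have cont_u: "continuous_on {0..X} u" unfolding u_def by (intro cont)
  have 3: "Lim (at_left X) (\<lambda>x. - of_real c * h \<mu> x + q \<mu> x) = u X"
    "Lim (at_right 0) (\<lambda>x. - of_real c * h \<mu> x + q \<mu> x) = u 0"
    using Lim_cell_endpoints[OF X_pos cont_u] by (simp_all add: u_def)
  have cont_v: "continuous_on {0..X} v" unfolding v_def by (intro cont cont_u nz)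
  have 4: "Lim (at_left X) (lin_flux F c H Q (h \<mu>) (q \<mu>)) = v X"
    "Lim (at_right 0) (lin_flux F c H Q (h \<mu>) (q \<mu>)) = v 0"
    using Lim_cell_endpoints[OF X_pos cont_v] by (simp_all add: lin_flux_eq v_def u_def)
  show ?thesis
    unfolding evans_lopatinsky_def det_2 vector_2 jump_def bloch_jump_def 1 2 3 4
    by (simp add: algebra_simps)
qed

section \<open>The normalized solutions at zero and the criterion for a double root\<close>

context
  fixes h q :: "complex \<Rightarrow> real \<Rightarrow> complex"
  assumes norm: "normalized_solutions F Hs X xs H Q h q"
begin

lemma open_spectral_domain: "open (spectral_domain F Hs)"
  unfolding spectral_domain_def by (rule open_halfspace_Re_gt)

lemma of_real_in_spectral_domain: "m \<ge> 0 \<Longrightarrow> of_real m \<in> spectral_domain F Hs"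
proof -
  have "- (F - 2) / (2 * s) < 0" using F s_pos by (intro divide_neg_pos) auto
  then show "m \<ge> 0 \<Longrightarrow> of_real m \<in> spectral_domain F Hs" unfolding spectral_domain_def by simp
qed

lemma solutions_continuous:
  assumes "\<mu> \<in> spectral_domain F Hs"
  shows "continuous_on {0..X} (h \<mu>)" "continuous_on {0..X} (q \<mu>)"
  using norm assms by (auto simp: normalized_solutions_def intro: real_analytic_on_imp_continuous_on)

lemma solutions_holomorphic:
  assumes "x \<in> {0..X}"
  shows "(\<lambda>\<mu>. h \<mu> x) holomorphic_on spectral_domain F Hs" "(\<lambda>\<mu>. q \<mu> x) holomorphic_on spectral_domain F Hs"
  using norm assms by (auto simp: normalized_solutions_def)

text \<open>Puts the sonic data into the form expected by \<open>perturbation_bound\<close>, with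
  \<open>\<kappa> * \<beta> * F = V Hs\<close> and
  \<open>U\<^sub>s = - 2 * s * \<kappa>\<close>.\<close>

lemma normalization_real:
  assumes "m \<ge> 0"
  shows "h (of_real m) xs = of_real (V Hs * (1 + m / \<beta>))"
    and "q (of_real m) xs - of_real c * h (of_real m) xs = of_real (m * U\<^sub>s)"
proof -
  define \<kappa> where "\<kappa> = (F - 2) / (2 * (F + 1)) * s"
  have \<beta>s: "\<beta> * s = 2/3 * (F + 1)" using s_pos by (simp add: \<beta>_def)
  have \<kappa>\<beta>: "\<kappa> * \<beta> = (F - 2) / 3"
  proof -
    have "\<kappa> * \<beta> = (F - 2) / (2 * (F + 1)) * (\<beta> * s)" by (simp add: \<kappa>_def)
    then show ?thesis unfolding \<beta>s using F by simp
  qed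
  have h: "h (of_real m) xs = of_real (\<kappa> * ((m + \<beta>) * F))"
    and q: "q (of_real m) xs = of_real (\<kappa> * (m * (s * (F - 1)) + 2/3 * (F + 1)^2))"
    using norm of_real_in_spectral_domain[OF assms]
    by (auto simp: normalized_solutions_def \<kappa>_def \<beta>_def)
  have "\<kappa> * ((m + \<beta>) * F) = (\<kappa> * \<beta>) * F * (1 + m / \<beta>)" using \<beta>_pos by (simp add: field_simps)
  also have "\<dots> = V Hs * (1 + m / \<beta>)" by (simp add: \<kappa>\<beta> V_sonic)
  finally show "h (of_real m) xs = of_real (V Hs * (1 + m / \<beta>))" using h by simp
  have "\<kappa> * (m * (s * (F - 1)) + 2/3 * (F + 1)^2) - c * (\<kappa> * ((m + \<beta>) * F)) =
      \<kappa> * (m * (s * (F - 1)) + (F + 1) * (2/3 * (F + 1)) - s * (F + 1) * (m + \<beta>))"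
    using F by (simp add: c_eq power2_eq_square field_simps)
  also have "\<dots> = - (2 * m * s * \<kappa>)" unfolding \<beta>s[symmetric] by (simp add: algebra_simps)
  also have "\<dots> = m * U\<^sub>s"
  proof -
    have "2 * (s * \<kappa>) = s^2 * (2 * ((F - 2) / (2 * (F + 1))))"
      unfolding \<kappa>_def by (simp only: power2_eq_square mult_ac)
    also have "s^2 = Hs" using Hs_pos by simp
    also have "2 * ((F - 2) / (2 * (F + 1))) = (F - 2) / (F + 1)"
      using F by (simp add: divide_simps algebra_simps)
    finally have "U\<^sub>s = - (2 * (s * \<kappa>))" by (simp add: U\<^sub>s_def)
    then show ?thesis by (simp add: algebra_simps)
  qed
  finally show "q (of_real m) xs - of_real c * h (of_real m) xs = of_real (m * U\<^sub>s)"
    unfolding h q by (simp only: flip: of_real_mult of_real_diff)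
qed

text \<open>Holomorphy in \<open>\<mu>\<close> at fixed \<open>x\<close> guarantees that the value
  and the derivative at \<open>0\<close> exist; both are then identified by their limits along
  positive reals, which \<open>perturbation_bound\<close> supplies.\<close>

lemma solutions_at_zero:
  assumes x: "x \<in> {0..X}"
  shows "h 0 x = of_real (V (H0 x))" "q 0 x - of_real c * h 0 x = 0"
    "((\<lambda>\<mu>. q \<mu> x - of_real c * h \<mu> x) has_field_derivative of_real (U\<^sub>s + Hs - H0 x)) (at 0)"
proof -
  obtain M where "M \<ge> 0" and M:
    "\<And>m h q x. \<lbrakk>0 < m; m \<le> 1; continuous_on {0..X} h; continuous_on {0..X} q;
       interior_solution F c X H Q (of_real m) h q;
       h xs = of_real (V Hs * (1 + m / \<beta>)); q xs - of_real c * h xs = of_real (m * U\<^sub>s);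
       x \<in> {0..X}\<rbrakk> \<Longrightarrow>
     norm (h x - of_real (V (H0 x))) \<le> M * m \<and>
     norm ((q x - of_real c * h x) /\<^sub>R m + of_real (H0 x) - of_real (U\<^sub>s + Hs)) \<le> M * m"
    using perturbation_bound by blast
  let ?h = "\<lambda>m::real. h (of_real m) x"
  define u where "u \<mu> = q \<mu> x - of_real c * h \<mu> x" for \<mu>
  have bound: "norm (?h m - of_real (V (H0 x))) \<le> M * m"
    "norm (u (of_real m) / of_real m - of_real (U\<^sub>s + Hs - H0 x)) \<le> M * m"
    if m: "m \<in> {0<..<1}" for m
  proof -
    have dom: "of_real m \<in> spectral_domain F Hs" using m by (intro of_real_in_spectral_domain) auto
    then have "interior_solution F c X H Q (of_real m) (h (of_real m)) (q (of_real m))"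
      using norm by (simp add: normalized_solutions_def)
    from M[OF _ _ solutions_continuous[OF dom] this normalization_real x] m
    show "norm (?h m - of_real (V (H0 x))) \<le> M * m"
      "norm (u (of_real m) / of_real m - of_real (U\<^sub>s + Hs - H0 x)) \<le> M * m"
      by (auto simp: u_def scaleR_conv_of_real divide_inverse algebra_simps)
  qed
  have small: "((\<lambda>m::real. M * m) \<longlongrightarrow> 0) (at_right 0)"
    by (auto intro!: tendsto_eq_intros)
  have ev: "\<forall>\<^sub>F m in at_right (0::real). m \<in> {0<..<1}"
    by (rule eventually_at_rightI[of 0 1]) auto
  have lim_h: "(?h \<longlongrightarrow> of_real (V (H0 x))) (at_right 0)"
    by (rule LIM_zero_cancel, rule Lim_null_comparison[OF _ small])
       (use ev bound in \<open>auto elim: eventually_mono\<close>)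
  have lim_u: "((\<lambda>m. u (of_real m) / of_real m) \<longlongrightarrow> of_real (U\<^sub>s + Hs - H0 x)) (at_right 0)"
    by (rule LIM_zero_cancel, rule Lim_null_comparison[OF _ small])
       (use ev bound in \<open>auto elim: eventually_mono\<close>)
  have 0: "0 \<in> spectral_domain F Hs" using of_real_in_spectral_domain[of 0] by simp
  have to0: "filterlim (of_real :: real \<Rightarrow> complex) (at 0) (at_right 0)"
    unfolding filterlim_at by (auto intro!: tendsto_eq_intros simp: eventually_at_filter)
  have u_hol: "u holomorphic_on spectral_domain F Hs"
    unfolding u_def by (intro holomorphic_intros solutions_holomorphic x)
  have "isCont (\<lambda>\<mu>. h \<mu> x) 0" "isCont u 0"
    using holomorphic_on_imp_continuous_on[OF solutions_holomorphic(1)[OF x]]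
      holomorphic_on_imp_continuous_on[OF u_hol] 0 open_spectral_domain
    by (auto simp: continuous_on_eq_continuous_at)
  then have lims: "(?h \<longlongrightarrow> h 0 x) (at_right 0)" "((\<lambda>m. u (of_real m)) \<longlongrightarrow> u 0) (at_right 0)"
    by (auto simp: isCont_def intro: filterlim_compose[OF _ to0])
  show "h 0 x = of_real (V (H0 x))"
    using tendsto_unique[OF _ lims(1) lim_h] by simp
  have "((\<lambda>m. of_real m * (u (of_real m) / of_real m)) \<longlongrightarrow> 0 * of_real (U\<^sub>s + Hs - H0 x)) (at_right 0)"
    using to0 by (intro tendsto_mult lim_u) (simp add: filterlim_at)
  then have "((\<lambda>m. u (of_real m)) \<longlongrightarrow> 0) (at_right 0)"
    by (rule Lim_transform_eventually[THEN tendsto_eq_rhs]) (auto simp: eventually_at_filter)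
  then have u0: "u 0 = 0" using tendsto_unique[OF _ lims(2)] by simp
  then show "q 0 x - of_real c * h 0 x = 0" by (simp add: u_def)
  \<comment> \<open>As \<open>u 0 = 0\<close>, the difference quotient at \<open>0\<close> is
    \<open>u \<mu> / \<mu>\<close>, whose limit along positive reals is known.\<close>
  obtain u' where u': "(u has_field_derivative u') (at 0)"
    using holomorphic_on_imp_differentiable_at[OF u_hol open_spectral_domain 0]
    by (auto simp: field_differentiable_def)
  then have "((\<lambda>m. u (of_real m) / of_real m) \<longlongrightarrow> u') (at_right 0)"
    using filterlim_compose[OF _ to0] by (auto simp: has_field_derivative_iff u0)
  then have "u' = of_real (U\<^sub>s + Hs - H0 x)" using tendsto_unique[OF _ _ lim_u] by simp
  then show "((\<lambda>\<mu>. q \<mu> x - of_real c * h \<mu> x) has_field_derivative of_real (U\<^sub>s + Hs - H0 x)) (at 0)"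
    using u' by (simp add: u_def[abs_def])
qed

text \<open>At \<open>\<mu> = 0\<close> one factor of each product in the determinant vanishes: the
  prefactor \<open>\<mu>\<close> in the first, the jump of \<open>u\<close> in the second. The
  derivative thus retains the jump of \<open>v\<close> at \<open>0\<close> and the derivative of the
  jump of \<open>u\<close>.\<close>

lemma root_of_mult_ge_2_evans_lopatinsky_iff:
  "root_of_mult_ge 2 (\<lambda>\<mu>. evans_lopatinsky F c X H Q h q \<mu> \<xi>) 0 \<longleftrightarrow>
     (1 - exp (\<i> * of_real (\<xi> * X))) *
       of_real ((Hp - Hm) * S Hm + (S Hp - S Hm) * (U\<^sub>s + Hs - Hm)) = 0"
proof -
  define E where "E = exp (\<i> * of_real (\<xi> * X))"
  define u where "u \<mu> x = q \<mu> x - of_real c * h \<mu> x" for \<mu> x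
  define v where "v \<mu> x = (c - 2 * q0 / H0 x) *\<^sub>R u \<mu> x + (S (H0 x) / V (H0 x)) *\<^sub>R h \<mu> x" for \<mu> x
  define f where "f \<mu> = \<mu> * of_real (Hp - Hm) * (v \<mu> X - E * v \<mu> 0) -
    (\<mu> * of_real (c * (Hp - Hm)) - of_real (S Hp - S Hm)) * (u \<mu> X - E * u \<mu> 0)" for \<mu>
  let ?\<Delta> = "\<lambda>\<mu>. evans_lopatinsky F c X H Q h q \<mu> \<xi>"
  let ?D = "spectral_domain F Hs"
  have ends: "0 \<in> {0..X}" "X \<in> {0..X}" using X_pos by auto
  have 0: "0 \<in> ?D" using of_real_in_spectral_domain[of 0] by simp
  have \<Delta>_eq: "?\<Delta> \<mu> = f \<mu>" if "\<mu> \<in> ?D" for \<mu>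
    using evans_lopatinsky_eq[of h \<mu> q \<xi>] solutions_continuous[OF that] by (simp add: f_def u_def v_def E_def)
  have v_hol: "(\<lambda>\<mu>. v \<mu> x) holomorphic_on ?D" if "x \<in> {0..X}" for x
    unfolding v_def u_def scaleR_conv_of_real by (intro holomorphic_intros solutions_holomorphic that)
  have "f holomorphic_on ?D"
    unfolding f_def by (intro holomorphic_intros v_hol ends)
      (auto simp: u_def intro!: holomorphic_intros solutions_holomorphic ends)
  then have hol: "?\<Delta> holomorphic_on ?D"
    by (rule holomorphic_transform) (simp add: \<Delta>_eq)
  then have an: "?\<Delta> analytic_on {0}"
    using holomorphic_on_imp_analytic_at[OF _ open_spectral_domain 0] by blast
  have v0: "v 0 x = of_real (S (H0 x))" if "x \<in> {0..X}" for x
    using solutions_at_zero(1,2)[OF that] V_H0_pos[OF that] by (simp add: v_def u_def scaleR_conv_of_real)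
  have u0: "u 0 x = 0" "((\<lambda>\<mu>. u \<mu> x) has_field_derivative of_real (U\<^sub>s + Hs - H0 x)) (at 0)"
    if "x \<in> {0..X}" for x
    using solutions_at_zero(2,3)[OF that] by (simp_all add: u_def)
  have f0: "f 0 = 0" using u0(1)[OF ends(1)] u0(1)[OF ends(2)] by (simp add: f_def)
  \<comment> \<open>Existence of the derivative of \<open>v\<close> is enough, since the product
    rule multiplies it by \<open>\<mu> = 0\<close>.\<close>
  obtain v' where v': "((\<lambda>\<mu>. v \<mu> X - E * v \<mu> 0) has_field_derivative v') (at 0)"
  proof -
    have "(\<lambda>\<mu>. v \<mu> X - E * v \<mu> 0) holomorphic_on ?D" by (intro holomorphic_intros v_hol ends)
    from holomorphic_on_imp_differentiable_at[OF this open_spectral_domain 0] that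
    show thesis by (auto simp: field_differentiable_def)
  qed
  have du: "((\<lambda>\<mu>. u \<mu> X - E * u \<mu> 0) has_field_derivative
      of_real (U\<^sub>s + Hs - Hp) - E * of_real (U\<^sub>s + Hs - Hm)) (at 0)"
    using DERIV_diff[OF u0(2)[OF ends(2)] DERIV_cmult[OF u0(2)[OF ends(1)], of E]]
    by (simp only: H0_ends)
  have "(f has_field_derivative
      of_real (Hp - Hm) * (of_real (S Hp) - E * of_real (S Hm)) +
      of_real (S Hp - S Hm) * (of_real (U\<^sub>s + Hs - Hp) - E * of_real (U\<^sub>s + Hs - Hm))) (at 0)"
    unfolding f_def
    by (rule DERIV_cong[OF DERIV_diff[OF DERIV_mult[OF _ v', where Da = "of_real (Hp - Hm)"]
          DERIV_mult[OF _ du, where Da = "of_real (c * (Hp - Hm))"]]])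
       (use ends in \<open>auto intro!: derivative_eq_intros simp: v0 u0(1) H0_ends algebra_simps\<close>)
  also have "of_real (Hp - Hm) * (of_real (S Hp) - E * of_real (S Hm)) +
      of_real (S Hp - S Hm) * (of_real (U\<^sub>s + Hs - Hp) - E * of_real (U\<^sub>s + Hs - Hm)) =
      (1 - E) * of_real ((Hp - Hm) * S Hm + (S Hp - S Hm) * (U\<^sub>s + Hs - Hm))"
    by (simp add: algebra_simps)
  finally have "(?\<Delta> has_field_derivative
      (1 - E) * of_real ((Hp - Hm) * S Hm + (S Hp - S Hm) * (U\<^sub>s + Hs - Hm))) (at 0)"
    by (rule has_field_derivative_transform_within_open[OF _ open_spectral_domain 0]) (simp add: \<Delta>_eq)
  then show ?thesis
    using root_of_mult_ge_2_iff[OF an] \<Delta>_eq[OF 0] f0 by (simp add: DERIV_imp_deriv E_def)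
qed

end

end

section \<open>Independence of the Floquet exponent\<close>

theorem corollary1p4:
  fixes F Hs Hm Hp X xs :: real
    and H Q :: "real \<Rightarrow> real"
    and h q :: "complex \<Rightarrow> real \<Rightarrow> complex"
  assumes "F > 2"
    and "roll_wave F Hs Hm Hp X H Q"
    and "xs \<in> {0<..<X}" and "H xs = Hs"
    and "normalized_solutions F Hs X xs H Q h q"
  defines "\<Delta> \<equiv> evans_lopatinsky F (rw_speed F Hs) X H Q h q"
  shows "(\<exists>\<xi>\<in>{- pi / X..pi / X}. \<xi> \<noteq> 0 \<and> root_of_mult_ge 2 (\<lambda>\<mu>. \<Delta> \<mu> \<xi>) 0) \<longleftrightarrow>
         (\<forall>\<xi>\<in>{- pi / X..pi / X}. root_of_mult_ge 2 (\<lambda>\<mu>. \<Delta> \<mu> \<xi>) 0)"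
proof -
  obtain H0 where H0: "cell_profile F Hs Hm Hp X H0"
    and HQ: "\<And>j::int. \<And>x. x \<in> {0<..<X} \<Longrightarrow> H (x + of_int j * X) = H0 x \<and>
           Q (x + of_int j * X) = rw_speed F Hs * H0 x - rw_q0 F Hs"
    using assms(2) unfolding roll_wave_def by blast
  have HQ0: "H x = H0 x" "Q x = rw_speed F Hs * H0 x - rw_q0 F Hs" if "x \<in> {0<..<X}" for x
    using HQ[OF that, of 0] by simp_all
  interpret roll_wave_cell F Hs Hm Hp X xs H0 H Q
    using assms(1,3,4) H0 HQ0 by unfold_locales auto
  note iff = root_of_mult_ge_2_evans_lopatinsky_iff[OF assms(5), folded \<Delta>_def]
  have ne: "exp (\<i> * of_real (\<xi> * X)) \<noteq> 1" if "\<xi> \<in> {- pi / X..pi / X}" "\<xi> \<noteq> 0" for \<xi>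
    by (rule exp_ii_ne_1) (use that X_pos in \<open>auto simp: abs_le_iff field_simps\<close>)
  \<comment> \<open>A nonzero exponent in the range gives the passage from all exponents to some.
    For the other direction, \<open>1 - exp (\<i> * of_real (\<xi> * X))\<close> is nonzero at the
    given exponent, so the factor independent of \<open>\<xi>\<close> vanishes.\<close>
  have "pi / X \<in> {- pi / X..pi / X}" "pi / X \<noteq> 0"
    using X_pos by (auto simp: field_simps)
  with ne show ?thesis
    unfolding iff by (metis mult_eq_0_iff right_minus_eq)
qed

end
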